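(* Let $r\ge0$ be an integer. A function $q\in V_r^2(T^{\rm ps})$ is uniquely determined by the following degrees of freedom: (a) $[\![q]\!](z_{3+i})$, $1\le i\le3$ ($3$ DOFs); (b) $\int_Tq$ ($1$ DOF); (c) $\int_Tq\,p$ for all $p\in\mathring{\mathcal V}_r^2(T^{\rm ps})$ ($3(r+1)(r+2)-4$ DOFs).
   Context: Let $T\subset\mathbb R^2$ be a (closed, nondegenerate) triangle with vertices $z_1,z_2,z_3$, labelled counter-clockwise, and let $z_0$ be a point in the interior of $T$. Let $e_i=[z_{i+1},z_{i+2}]$ (indices $1,2,3$ modulo $3$) be the edge opposite $z_i$, and let $z_{3+i}$ be a point in the relative interior of $e_i$, $i=1,2,3$. The Powell--Sabin split $T^{\rm ps}=\{T_1,\dots,T_6\}$ is the triangulation of $T$ obtained by connecting $z_0$ to each of $z_1,\dots,z_6$. $\mathcal P_r(S)$ is the space of polynomials of degree $\le r$ on $S$; $V_r^2(T^{\rm ps})=\{q\in L^2(T): q|_S\in\mathcal P_r(S)\ \forall S\in T^{\rm ps}\}$; $\mathring{\mathcal V}_r^2(T^{\rm ps})=\{q\in V_r^2(T^{\rm ps}): q\text{ is continuous at }z_4,z_5,z_6,\ \int_Tq=0\}$. Jump: if $K_1,K_2\in T^{\rm ps}$ are the two triangles having $z_{3+i}$ as a vertex, with common edge $e$, and $m_j$ is the unit normal to $e$ pointing out of $K_j$, then $[\![p]\!](z_{3+i})=p|_{K_1}(z_{3+i})m_1+p|_{K_2}(z_{3+i})m_2=(p|_{K_1}(z_{3+i})-p|_{K_2}(z_{3+i}))m_1$;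 it counts as one scalar degree of freedom. "Uniquely determined by the degrees of freedom" means that the degrees of freedom are unisolvent: their number equals the dimension of the space (here $\dim V_r^2(T^{\rm ps})=3(r+1)(r+2)$), and the only function in the space at which all of them vanish is $0$. *)

theory Defs
  imports "HOL-Analysis.Analysis"
begin

section \<open>The Powell--Sabin split\<close>

text \<open>A configuration is a map \<open>z\<close> on the indices \<open>0, ..., 6\<close>; other indices are irrelevant.
  \<open>nxt\<close> is the cyclic successor on \<open>{1,2,3}\<close>, so the edge opposite \<open>z i\<close> is
  \<open>[z (nxt i), z (nxt (nxt i))]\<close>.\<close>

definition nxt :: "nat \<Rightarrow> nat" where
  "nxt i = i mod 3 + 1"

definition big_triangle :: "(nat \<Rightarrow> real^2) \<Rightarrow> (real^2) set" where
  "big_triangle z = convex hull {z 1, z 2, z 3}"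

text \<open>Positivity of the determinant says that the vertices are in counter-clockwise order,
  and in particular that they are not collinear.\<close>

definition powell_sabin :: "(nat \<Rightarrow> real^2) \<Rightarrow> bool" where
  "powell_sabin z \<longleftrightarrow>
     det (vector [z 2 - z 1, z 3 - z 1] :: real^2^2) > 0 \<and>
     z 0 \<in> interior (big_triangle z) \<and>
     (\<forall>i\<in>{1..3}. z (3 + i) \<in> open_segment (z (nxt i)) (z (nxt (nxt i))))"

text \<open>The subtriangle with vertices \<open>z 0\<close>, \<open>z (3 + i)\<close>, \<open>z j\<close>, where \<open>z (3 + i)\<close> lies on the edge
  opposite \<open>z i\<close> and \<open>z j\<close> is an endpoint of that edge.\<close>

definition ps_triangle :: "(nat \<Rightarrow> real^2) \<Rightarrow> nat \<Rightarrow> nat \<Rightarrow> (real^2) set" where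
  "ps_triangle z i j = convex hull {z 0, z (3 + i), z j}"

definition ps_split :: "(nat \<Rightarrow> real^2) \<Rightarrow> (real^2) set set" where
  "ps_split z = {ps_triangle z i j | i j. i \<in> {1..3} \<and> j \<in> {1..3} \<and> i \<noteq> j}"


section \<open>Piecewise polynomials\<close>

definition polys :: "nat \<Rightarrow> (real^2 \<Rightarrow> real) set" where
  "polys r = {p. \<exists>c :: nat \<Rightarrow> nat \<Rightarrow> real.
     \<forall>x. p x = (\<Sum>i\<le>r. \<Sum>j\<le>r - i. c i j * (x $ 1) ^ i * (x $ 2) ^ j)}"

definition L2_on :: "(real^2) set \<Rightarrow> (real^2 \<Rightarrow> real) set" where
  "L2_on T = {q. q \<in> borel_measurable (lebesgue_on T) \<and>
                 integrable (lebesgue_on T) (\<lambda>x. (q x)\<^sup>2)}"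

text \<open>Elements of \<open>L\<^sup>2(T)\<close> are represented by functions, to be identified when they agree
  almost everywhere on \<open>T\<close>; accordingly bases, dimension and vanishing below are all understood
  modulo null sets, and the values outside \<open>T\<close> play no role.\<close>

definition V2 :: "nat \<Rightarrow> (nat \<Rightarrow> real^2) \<Rightarrow> (real^2 \<Rightarrow> real) set" where
  "V2 r z = {q \<in> L2_on (big_triangle z).
     \<forall>S\<in>ps_split z. \<exists>p\<in>polys r. AE x in lebesgue_on S. q x = p x}"

text \<open>Continuity of an \<open>L\<^sup>2\<close> class at a point: some representative is continuous there, as a
  function on \<open>T\<close>.\<close>

definition ae_continuous_at :: "(real^2) set \<Rightarrow> (real^2 \<Rightarrow> real) \<Rightarrow> real^2 \<Rightarrow> bool" where
  "ae_continuous_at T q y \<longleftrightarrow>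
     (\<exists>g. (AE x in lebesgue_on T. g x = q x) \<and> continuous (at y within T) g)"

definition V2_ring :: "nat \<Rightarrow> (nat \<Rightarrow> real^2) \<Rightarrow> (real^2 \<Rightarrow> real) set" where
  "V2_ring r z = {q \<in> V2 r z.
     (\<forall>i\<in>{1..3}. ae_continuous_at (big_triangle z) q (z (3 + i))) \<and>
     integral\<^sup>L (lebesgue_on (big_triangle z)) q = 0}"


section \<open>Jumps\<close>

text \<open>The polynomial \<open>q|\<^sub>K\<close>; it is unique when \<open>K\<close> has nonempty interior, and it gives a meaning
  to point values of \<open>q|\<^sub>K\<close> on the boundary of \<open>K\<close>.\<close>

definition restr :: "nat \<Rightarrow> (real^2) set \<Rightarrow> (real^2 \<Rightarrow> real) \<Rightarrow> real^2 \<Rightarrow> real" where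
  "restr r K q = (THE p. p \<in> polys r \<and> (AE x in lebesgue_on K. q x = p x))"

text \<open>The unit normal to the edge \<open>[a, b]\<close> pointing out of the triangle with vertices \<open>a\<close>, \<open>b\<close>, \<open>c\<close>.\<close>

definition outward_normal :: "real^2 \<Rightarrow> real^2 \<Rightarrow> real^2 \<Rightarrow> real^2" where
  "outward_normal a b c = (THE m. norm m = 1 \<and> m \<bullet> (b - a) = 0 \<and> m \<bullet> (c - a) < 0)"

text \<open>The jump at \<open>z (3 + i)\<close> is taken across the common edge \<open>[z 0, z (3 + i)]\<close> of the triangles
  \<open>K\<^sub>1\<close>, \<open>K\<^sub>2\<close> with third vertex \<open>z (nxt i)\<close>, \<open>z (nxt (nxt i))\<close>. \<open>ps_normal z i j\<close> is the normal
  pointing out of \<open>ps_triangle z i j\<close>.\<close>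

definition ps_normal :: "(nat \<Rightarrow> real^2) \<Rightarrow> nat \<Rightarrow> nat \<Rightarrow> real^2" where
  "ps_normal z i j = outward_normal (z 0) (z (3 + i)) (z j)"

definition jump :: "nat \<Rightarrow> (nat \<Rightarrow> real^2) \<Rightarrow> (real^2 \<Rightarrow> real) \<Rightarrow> nat \<Rightarrow> real^2" where
  "jump r z q i =
     (let j1 = nxt i; j2 = nxt (nxt i) in
       restr r (ps_triangle z i j1) q (z (3 + i)) *\<^sub>R ps_normal z i j1 +
       restr r (ps_triangle z i j2) q (z (3 + i)) *\<^sub>R ps_normal z i j2)"

text \<open>The jump is a multiple of the unit vector \<open>m\<^sub>1\<close>, so its component along \<open>m\<^sub>1\<close> is the single
  scalar degree of freedom that it carries.\<close>

definition jump_dof :: "nat \<Rightarrow> (nat \<Rightarrow> real^2) \<Rightarrow> nat \<Rightarrow> (real^2 \<Rightarrow> real) \<Rightarrow> real" where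
  "jump_dof r z i q = jump r z q i \<bullet> ps_normal z i (nxt i)"


section \<open>Dimension and unisolvence modulo null sets\<close>

definition ae_basis ::
    "(real^2) set \<Rightarrow> (real^2 \<Rightarrow> real) set \<Rightarrow> nat \<Rightarrow> (nat \<Rightarrow> real^2 \<Rightarrow> real) \<Rightarrow> bool" where
  "ae_basis T V n b \<longleftrightarrow>
     (\<forall>k<n. b k \<in> V) \<and>
     (\<forall>c :: nat \<Rightarrow> real.
        (AE x in lebesgue_on T. (\<Sum>k<n. c k * b k x) = 0) \<longrightarrow> (\<forall>k<n. c k = 0)) \<and>
     (\<forall>q\<in>V. \<exists>c :: nat \<Rightarrow> real. AE x in lebesgue_on T. q x = (\<Sum>k<n. c k * b k x))"

definition ae_has_dim :: "(real^2) set \<Rightarrow> (real^2 \<Rightarrow> real) set \<Rightarrow> nat \<Rightarrow> bool" where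
  "ae_has_dim T V n \<longleftrightarrow> (\<exists>b. ae_basis T V n b)"

definition unisolvent ::
    "(real^2) set \<Rightarrow> (real^2 \<Rightarrow> real) set \<Rightarrow> ((real^2 \<Rightarrow> real) \<Rightarrow> real) list \<Rightarrow> bool" where
  "unisolvent T V L \<longleftrightarrow>
     ae_has_dim T V (length L) \<and>
     (\<forall>q\<in>V. (\<forall>l\<in>set L. l q = 0) \<longrightarrow> (AE x in lebesgue_on T. q x = 0))"

text \<open>The moments against all \<open>p\<close> in a space amount to those against the members
  \<open>b 0, ..., b (n - 1)\<close> of a basis of it, and are counted in this way.\<close>

definition dofs ::
    "nat \<Rightarrow> (nat \<Rightarrow> real^2) \<Rightarrow> nat \<Rightarrow> (nat \<Rightarrow> real^2 \<Rightarrow> real) \<Rightarrow> ((real^2 \<Rightarrow> real) \<Rightarrow> real) list" where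
  "dofs r z n b =
     map (jump_dof r z) [1, 2, 3] @
     [\<lambda>q. integral\<^sup>L (lebesgue_on (big_triangle z)) q] @
     map (\<lambda>k q. LINT x|lebesgue_on (big_triangle z). q x * b k x) [0..<n]"

end

theory Submission
  imports Defs
begin

text \<open>Taking a jump at each of \<open>z 4\<close>, \<open>z 5\<close>, \<open>z 6\<close> and the mean value gives four linear functionals
  on the piecewise polynomials. They are independent: the indicator function of one of the two
  triangles at \<open>z (3 + i)\<close> has a jump there and at neither of the other two points, and the
  constant 1 has no jumps but a nonzero integral. A piecewise polynomial has a representative that
  is continuous at \<open>z (3 + i)\<close> exactly if its jump there vanishes, so the common kernel of the four
  functionals is the space \<open>V2_ring\<close>, of codimension 4. A function \<open>q\<close> at which all degrees of
  freedom vanish therefore lies in \<open>V2_ring\<close> and is orthogonal to it, in particular to itself.\<close>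

section \<open>Kernels of functionals on spaces of functions modulo null sets\<close>

text \<open>No quotient by null sets is formed. Functions stay representatives, so subspaces,
  functionals and bases are handled with explicit almost-everywhere hypotheses, and the linear
  algebra reduces to one elementary pivot argument, \<open>ae_has_dim_kernel\<close>, which lowers
  the dimension by one. Codimension 4 comes from applying it four times; this is why each witness
  must lie in the kernels already taken, and not merely be nonzero under its own functional. The
  obstacle is that a jump is a point value on a null set. It becomes meaningful because a polynomial
  is determined by its almost-everywhere class on any set with nonempty interior, and because each
  triangle is the closure of its interior, so identities inside reach the boundary point
  \<open>z (3 + i)\<close>. Conversely, vanishing of the jump yields continuity since the other four
  triangles form a closed set that misses \<open>z (3 + i)\<close>: near that point only two
  polynomials matter.\<close>

definition function_space :: "('a \<Rightarrow> real) set \<Rightarrow> bool" where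
  "function_space V \<longleftrightarrow> (\<lambda>x. 0) \<in> V \<and> (\<forall>u\<in>V. \<forall>v\<in>V. \<forall>a. (\<lambda>x. u x + a * v x) \<in> V)"

text \<open>Both conditions are relative to \<open>V\<close>, because the jump functionals go
  through the \<open>THE\<close> in \<open>restr\<close> and are controlled only on piecewise
  polynomials. The second condition says that \<open>l\<close> descends to classes modulo null
  sets.\<close>

definition ae_functional ::
    "(real^2) set \<Rightarrow> (real^2 \<Rightarrow> real) set \<Rightarrow> ((real^2 \<Rightarrow> real) \<Rightarrow> real) \<Rightarrow> bool" where
  "ae_functional T V l \<longleftrightarrow>
     (\<forall>u\<in>V. \<forall>v\<in>V. \<forall>a. l (\<lambda>x. u x + a * v x) = l u + a * l v) \<and>
     (\<forall>u\<in>V. \<forall>v\<in>V. (AE x in lebesgue_on T. u x = v x) \<longrightarrow> l u = l v)"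

text \<open>Arbitrary index sets make it possible to delete one basis element without renumbering,
  and to index a basis by a triangle together with a pair of exponents.\<close>

definition ae_basis_on ::
    "(real^2) set \<Rightarrow> (real^2 \<Rightarrow> real) set \<Rightarrow> 'i set \<Rightarrow> ('i \<Rightarrow> real^2 \<Rightarrow> real) \<Rightarrow> bool" where
  "ae_basis_on T V I b \<longleftrightarrow>
     (\<forall>k\<in>I. b k \<in> V) \<and>
     (\<forall>c :: 'i \<Rightarrow> real.
        (AE x in lebesgue_on T. (\<Sum>k\<in>I. c k * b k x) = 0) \<longrightarrow> (\<forall>k\<in>I. c k = 0)) \<and>
     (\<forall>q\<in>V. \<exists>c :: 'i \<Rightarrow> real. AE x in lebesgue_on T. q x = (\<Sum>k\<in>I. c k * b k x))"

lemma function_spaceD: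
  assumes "function_space V"
  shows "(\<lambda>x. 0) \<in> V" "u \<in> V \<Longrightarrow> v \<in> V \<Longrightarrow> (\<lambda>x. u x + a * v x) \<in> V"
  using assms by (simp_all add: function_space_def)

lemma ae_functionalD:
  assumes "ae_functional T V l" "u \<in> V" "v \<in> V"
  shows "l (\<lambda>x. u x + a * v x) = l u + a * l v"
    "AE x in lebesgue_on T. u x = v x \<Longrightarrow> l u = l v"
proof -
  have "\<forall>u\<in>V. \<forall>v\<in>V. \<forall>a. l (\<lambda>x. u x + a * v x) = l u + a * l v"
    "\<forall>u\<in>V. \<forall>v\<in>V. (AE x in lebesgue_on T. u x = v x) \<longrightarrow> l u = l v"
    using assms(1) unfolding ae_functional_def by (rule conjunct1, rule conjunct2)
  from this[rule_format, OF assms(2,3)]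
  show "l (\<lambda>x. u x + a * v x) = l u + a * l v"
    "AE x in lebesgue_on T. u x = v x \<Longrightarrow> l u = l v" .
qed

lemma ae_basis_onD:
  assumes "ae_basis_on T V I b"
  shows "k \<in> I \<Longrightarrow> b k \<in> V"
    "AE x in lebesgue_on T. (\<Sum>k\<in>I. c k * b k x) = 0 \<Longrightarrow> k \<in> I \<Longrightarrow> c k = 0"
    "q \<in> V \<Longrightarrow> \<exists>c. AE x in lebesgue_on T. q x = (\<Sum>k\<in>I. c k * b k x)"
  using assms by (simp_all add: ae_basis_on_def)

lemma ae_basis_eq_on: "ae_basis T V n b \<longleftrightarrow> ae_basis_on T V {..<n} b"
  by (simp add: ae_basis_def ae_basis_on_def Ball_def)

lemma ae_has_dim_card:
  assumes "finite I" and B: "ae_basis_on T V I b"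
  shows "ae_has_dim T V (card I)"
proof -
  obtain h where h: "bij_betw h {..<card I} I"
    using ex_bij_betw_nat_finite[OF \<open>finite I\<close>] by (auto simp: atLeast0LessThan)
  have img: "h ` {..<card I} = I" and inj: "inj_on h {..<card I}"
    using h by (auto simp: bij_betw_def)
  have reindex: "(\<Sum>k<card I. c (h k) * b (h k) x) = (\<Sum>k\<in>I. c k * b k x)" for c and x
    by (rule sum.reindex_bij_betw[OF h, of "\<lambda>k. c k * b k x"])
  have "ae_basis T V (card I) (b \<circ> h)"
    unfolding ae_basis_def
  proof (intro conjI allI impI ballI)
    fix k assume "k < card I"
    then show "(b \<circ> h) k \<in> V"
      using B img unfolding ae_basis_on_def by auto
  next
    fix c :: "nat \<Rightarrow> real" and k
    assume z: "AE x in lebesgue_on T. (\<Sum>k<card I. c k * (b \<circ> h) k x) = 0" and k: "k < card I"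
    let ?d = "\<lambda>i. c (inv_into {..<card I} h i)"
    have "(\<Sum>k<card I. c k * (b \<circ> h) k x) = (\<Sum>k\<in>I. ?d k * b k x)" for x
      unfolding reindex[symmetric] by (rule sum.cong) (auto simp: inj)
    with z have "AE x in lebesgue_on T. (\<Sum>k\<in>I. ?d k * b k x) = 0"
      by simp
    then have "?d (h k) = 0"
      by (rule ae_basis_onD(2)[OF B]) (use img k in blast)
    then show "c k = 0"
      using k inj by simp
  next
    fix q assume "q \<in> V"
    from ae_basis_onD(3)[OF B this]
    obtain c where "AE x in lebesgue_on T. q x = (\<Sum>k\<in>I. c k * b k x)" ..
    then show "\<exists>c. AE x in lebesgue_on T. q x = (\<Sum>k<card I. c k * (b \<circ> h) k x)"
      by (intro exI[of _ "c \<circ> h"]) (simp add: reindex)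
  qed
  then show ?thesis
    unfolding ae_has_dim_def by blast
qed

lemma function_space_sum:
  assumes "function_space V" "finite I" "\<And>k. k \<in> I \<Longrightarrow> b k \<in> V"
  shows "(\<lambda>x. \<Sum>k\<in>I. c k * b k x) \<in> V"
  using assms(2,3)
proof (induction I rule: finite_induct)
  case empty
  then show ?case using assms(1) by (simp add: function_space_def)
next
  case (insert i I)
  then have "(\<lambda>x. (\<Sum>k\<in>I. c k * b k x) + c i * b i x) \<in> V"
    by (intro function_spaceD(2)[OF assms(1)]) auto
  with insert show ?case by (simp add: add.commute)
qed

lemma ae_functional_zero:
  assumes "function_space V" "ae_functional T V l"
  shows "l (\<lambda>x. 0) = 0"
proof -
  have "l (\<lambda>x. 0 + 1 * 0) = l (\<lambda>x. 0) + 1 * l (\<lambda>x. 0)"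
    by (intro ae_functionalD(1)[OF assms(2)] function_spaceD(1)[OF assms(1)])
  then show ?thesis by simp
qed

lemma ae_functional_sum:
  assumes V: "function_space V" and l: "ae_functional T V l"
    and "finite I" "\<And>k. k \<in> I \<Longrightarrow> b k \<in> V"
  shows "l (\<lambda>x. \<Sum>k\<in>I. c k * b k x) = (\<Sum>k\<in>I. c k * l (b k))"
  using assms(3,4)
proof (induction I rule: finite_induct)
  case empty
  then show ?case using ae_functional_zero[OF V l] by simp
next
  case (insert i I)
  have "(\<lambda>x. \<Sum>k\<in>I. c k * b k x) \<in> V"
    using function_space_sum[OF V] insert by blast
  then have "l (\<lambda>x. (\<Sum>k\<in>I. c k * b k x) + c i * b i x)
      = l (\<lambda>x. \<Sum>k\<in>I. c k * b k x) + c i * l (b i)"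
    using insert.prems by (intro ae_functionalD(1)[OF l]) auto
  with insert show ?case by (simp add: add.commute)
qed

lemma function_space_kernel:
  assumes "function_space V" "ae_functional T V l"
  shows "function_space {q\<in>V. l q = 0}"
  using assms ae_functional_zero[OF assms] by (auto simp: function_space_def ae_functional_def)

lemma ae_functional_subset:
  "ae_functional T V l \<Longrightarrow> W \<subseteq> V \<Longrightarrow> ae_functional T W l"
  unfolding ae_functional_def by blast

text \<open>Gaussian elimination with one pivot: some basis element \<open>b m\<close> has
  \<open>l (b m)\<close> nonzero, since otherwise \<open>l\<close> would vanish at \<open>u\<close>.
  Correcting the other basis elements by multiples of \<open>b m\<close> moves them into the kernel,
  where they form a basis.\<close>

lemma ae_has_dim_kernel:
  assumes V: "function_space V" and l: "ae_functional T V l"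
    and dim: "ae_has_dim T V (Suc n)" and u: "u \<in> V" "l u \<noteq> 0"
  shows "ae_has_dim T {q\<in>V. l q = 0} n"
proof -
  obtain b where B: "ae_basis_on T V {..<Suc n} b"
    using dim unfolding ae_has_dim_def ae_basis_eq_on by blast
  let ?I = "{..<Suc n}"
  have bV: "b k \<in> V" if "k \<in> ?I" for k
    using ae_basis_onD(1)[OF B that] .
  have l_expand: "l q = (\<Sum>k\<in>?I. c k * l (b k))"
    if "q \<in> V" "AE x in lebesgue_on T. q x = (\<Sum>k\<in>?I. c k * b k x)" for q c
  proof -
    have "l q = l (\<lambda>x. \<Sum>k\<in>?I. c k * b k x)"
      by (rule ae_functionalD(2)[OF l that(1) function_space_sum[OF V _ bV] that(2)]) auto
    also have "\<dots> = (\<Sum>k\<in>?I. c k * l (b k))"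
      by (rule ae_functional_sum[OF V l _ bV]) auto
    finally show ?thesis .
  qed
  obtain m where m: "m \<in> ?I" "l (b m) \<noteq> 0"
  proof -
    obtain c where "AE x in lebesgue_on T. u x = (\<Sum>k\<in>?I. c k * b k x)"
      using ae_basis_onD(3)[OF B u(1)] ..
    from l_expand[OF u(1) this] have "(\<Sum>k\<in>?I. c k * l (b k)) \<noteq> 0"
      using u(2) by simp
    then obtain k where "k \<in> ?I" "c k * l (b k) \<noteq> 0"
      by (rule sum.not_neutral_contains_not_neutral)
    then show ?thesis using that by auto
  qed
  \<comment> \<open>The multiple of \<open>b m\<close> that cancels the value of \<open>l\<close> at
    \<open>b k\<close>.\<close>
  define s where "s k = - l (b k) / l (b m)" for k
  define d where "d k = (\<lambda>x. b k x + s k * b m x)" for k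
  have d: "d k \<in> V" "l (d k) = 0" if "k \<in> ?I" for k
  proof -
    show "d k \<in> V"
      unfolding d_def by (intro function_spaceD(2)[OF V] bV that m(1))
    have "l (d k) = l (b k) + s k * l (b m)"
      unfolding d_def by (intro ae_functionalD(1)[OF l] bV that m(1))
    then show "l (d k) = 0"
      using m(2) by (simp add: s_def)
  qed
  have split: "(\<Sum>k\<in>?I. f k) = f m + (\<Sum>k\<in>?I - {m}. f k)" for f :: "nat \<Rightarrow> real"
    using m(1) by (intro sum.remove) auto
  \<comment> \<open>Rewritten in the old basis, a combination of the \<open>d k\<close> keeps the
    coefficients off \<open>m\<close> and collects all corrections at \<open>m\<close>. Independence
    and spanning are both read off from this.\<close>
  have sum_d: "(\<Sum>k\<in>?I - {m}. c k * d k x)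
      = (\<Sum>k\<in>?I. (if k = m then \<Sum>j\<in>?I - {m}. c j * s j else c k) * b k x)" for c :: "nat \<Rightarrow> real" and x
  proof -
    have "(\<Sum>k\<in>?I - {m}. (if k = m then \<Sum>j\<in>?I - {m}. c j * s j else c k) * b k x)
        = (\<Sum>k\<in>?I - {m}. c k * b k x)"
      by (intro sum.cong) auto
    then show ?thesis
      unfolding split by (simp add: d_def distrib_left sum.distrib sum_distrib_right mult.assoc)
  qed
  have "ae_basis_on T {q\<in>V. l q = 0} (?I - {m}) d"
    unfolding ae_basis_on_def
  proof (intro conjI allI impI ballI)
    fix k assume "k \<in> ?I - {m}"
    then show "d k \<in> {q \<in> V. l q = 0}" using d by auto
  next
    fix c :: "nat \<Rightarrow> real" and k
    assume "AE x in lebesgue_on T. (\<Sum>k\<in>?I - {m}. c k * d k x) = 0" and k: "k \<in> ?I - {m}"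
    from this(1)[unfolded sum_d]
    have "(if k = m then \<Sum>j\<in>?I - {m}. c j * s j else c k) = 0"
      by (rule ae_basis_onD(2)[OF B]) (use k in blast)
    then show "c k = 0" using k by auto
  next
    fix q assume "q \<in> {q \<in> V. l q = 0}"
    then have q: "q \<in> V" "l q = 0" by auto
    obtain c where c: "AE x in lebesgue_on T. q x = (\<Sum>k\<in>?I. c k * b k x)"
      using ae_basis_onD(3)[OF B q(1)] ..
    have "c m * l (b m) + (\<Sum>k\<in>?I - {m}. c k * l (b k)) = 0"
      using l_expand[OF q(1) c] q(2) unfolding split by linarith
    \<comment> \<open>The condition \<open>l q = 0\<close> forces the coefficient of
      \<open>b m\<close> to be the one that the corrections produce.\<close>
    then have "c m = (\<Sum>k\<in>?I - {m}. c k * s k)"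
      using m(2) by (simp add: s_def sum_negf field_simps flip: sum_divide_distrib)
    then have "(\<Sum>k\<in>?I. c k * b k x) = (\<Sum>k\<in>?I - {m}. c k * d k x)" for x
      unfolding sum_d by (intro sum.cong) auto
    then show "\<exists>c. AE x in lebesgue_on T. q x = (\<Sum>k\<in>?I - {m}. c k * d k x)"
      using c by auto
  qed
  from ae_has_dim_card[OF _ this] show ?thesis
    using m(1) by simp
qed

section \<open>Polynomials in two variables\<close>

lemma AE_lebesgue_on_iff:
  assumes "S \<in> sets lebesgue"
  shows "(AE x in lebesgue_on S. P x) \<longleftrightarrow> (AE x in lebesgue. x \<in> S \<longrightarrow> P x)"
  using assms by (simp add: AE_restrict_space_iff)

lemma AE_lebesgue_on_mono:
  assumes "AE x in lebesgue_on T. P x" "S \<subseteq> T" "S \<in> sets lebesgue" "T \<in> sets lebesgue"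
  shows "AE x in lebesgue_on S. P x"
  using assms by (auto simp: AE_lebesgue_on_iff elim: eventually_mono)

text \<open>The zero set is closed and contains almost every point of the open set
  \<open>interior S\<close>, hence all of it, hence also its closure.\<close>

lemma continuous_ae_zero_closure_interior:
  fixes f :: "'a::euclidean_space \<Rightarrow> real"
  assumes f: "continuous_on UNIV f" and S: "S \<in> sets lebesgue"
    and ae: "AE x in lebesgue_on S. f x = 0" and x: "x \<in> closure (interior S)"
  shows "f x = 0"
proof -
  have cl: "closed {x. f x = 0}"
    using f by (simp add: closed_Collect_eq)
  have "AE x\<in>interior S in lebesgue. x \<in> {x. f x = 0}"
    using ae S interior_subset by (auto simp: AE_lebesgue_on_iff elim!: eventually_mono)
  then have "interior S \<subseteq> {x. f x = 0}"
    using mem_closed_if_AE_lebesgue_open[OF open_interior cl] by blast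
  then show ?thesis
    using x closure_minimal[OF _ cl] by blast
qed

lemma cart2_ball_coordinate_box:
  fixes a :: "real^2"
  assumes "e > 0"
  obtains d where "d > 0" "\<And>s t. \<bar>s - a$1\<bar> < d \<Longrightarrow> \<bar>t - a$2\<bar> < d \<Longrightarrow> vector [s, t] \<in> ball a e"
proof
  show "e/2 > 0" using assms by simp
  fix s t assume st: "\<bar>s - a$1\<bar> < e/2" "\<bar>t - a$2\<bar> < e/2"
  have "norm (a - vector [s, t]) \<le> (\<Sum>i\<in>UNIV. \<bar>(a - vector [s, t])$i\<bar>)"
    by (rule norm_le_l1_cart)
  also have "\<dots> < e"
    using st unfolding sum_2 vector_minus_component vector_2 by linarith
  finally show "vector [s, t] \<in> ball a e"
    by (simp add: dist_norm)
qed

lemma infinite_abs_less: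
  fixes a d :: real assumes "d > 0" shows "infinite {s. \<bar>s - a\<bar> < d}"
proof -
  have "{a<..<a+d} \<subseteq> {s. \<bar>s - a\<bar> < d}" by auto
  moreover have "infinite {a<..<a+d}" using assms by (simp add: infinite_Ioo)
  ultimately show ?thesis by (rule infinite_super)
qed

text \<open>For fixed \<open>t\<close> the sum is a polynomial in \<open>s\<close> with infinitely
  many roots, so each of its coefficients vanishes. These coefficients are polynomials in
  \<open>t\<close> with infinitely many roots, and the same argument applies again.\<close>

lemma bivariate_polyfun_zero:
  fixes c :: "nat \<Rightarrow> nat \<Rightarrow> real"
  assumes A: "infinite A" and B: "infinite B"
    and z: "\<And>s t. s \<in> A \<Longrightarrow> t \<in> B \<Longrightarrow> (\<Sum>i\<le>r. \<Sum>j\<le>m i. c i j * s ^ i * t ^ j) = 0"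
    and "i \<le> r" "j \<le> m i"
  shows "c i j = 0"
proof -
  have "(\<Sum>j\<le>m i. c i j * t ^ j) = 0" if t: "t \<in> B" for t
  proof (rule ccontr)
    assume n0: "(\<Sum>j\<le>m i. c i j * t ^ j) \<noteq> 0"
    have "A \<subseteq> {s. (\<Sum>i\<le>r. (\<Sum>j\<le>m i. c i j * t ^ j) * s ^ i) = 0}"
      using z[OF _ t] by (auto simp: sum_distrib_left sum_distrib_right mult_ac)
    then have "infinite {s. (\<Sum>i\<le>r. (\<Sum>j\<le>m i. c i j * t ^ j) * s ^ i) = 0}"
      using A finite_subset by blast
    then show False
      using n0 \<open>i \<le> r\<close> unfolding polyfun_finite_roots by blast
  qed
  then have "B \<subseteq> {t. (\<Sum>j\<le>m i. c i j * t ^ j) = 0}" by auto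
  then have "infinite {t. (\<Sum>j\<le>m i. c i j * t ^ j) = 0}"
    using B finite_subset by blast
  then show ?thesis
    using \<open>j \<le> m i\<close> unfolding polyfun_finite_roots by blast
qed

lemma continuous_on_sum_monomials:
  "continuous_on A (\<lambda>x :: real^2. \<Sum>i\<le>r. \<Sum>j\<le>m i. c i j * (x$1) ^ i * (x$2) ^ j)"
  by (intro continuous_intros)

text \<open>The interior contains a product of two coordinate intervals, on which the polynomial
  vanishes everywhere by continuity. This serves both the uniqueness of \<open>restr\<close> and the
  linear independence of the piecewise monomials.\<close>

lemma coefficients_zero_ae:
  fixes c :: "nat \<Rightarrow> nat \<Rightarrow> real" and S :: "(real^2) set"
  assumes S: "S \<in> sets lebesgue" "interior S \<noteq> {}"
    and ae: "AE x in lebesgue_on S. (\<Sum>i\<le>r. \<Sum>j\<le>m i. c i j * (x$1) ^ i * (x$2) ^ j) = 0"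
    and ij: "i \<le> r" "j \<le> m i"
  shows "c i j = 0"
proof -
  obtain a e where e: "e > 0" "ball a e \<subseteq> interior S"
    using S(2) by (meson ex_in_conv open_contains_ball open_interior)
  obtain d where d: "d > 0"
    and box: "\<And>s t. \<bar>s - a$1\<bar> < d \<Longrightarrow> \<bar>t - a$2\<bar> < d \<Longrightarrow> vector [s, t] \<in> ball a e"
    using cart2_ball_coordinate_box[OF e(1), of a] by metis
  show ?thesis
  proof (rule bivariate_polyfun_zero[where m = m, OF infinite_abs_less[OF d, of "a$1"]
        infinite_abs_less[OF d, of "a$2"] _ ij])
    fix s t assume "s \<in> {s. \<bar>s - a$1\<bar> < d}" "t \<in> {t. \<bar>t - a$2\<bar> < d}"
    then have "vector [s, t] \<in> closure (interior S)"
      using box[of s t] e(2) closure_subset[of "interior S"] by blast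
    from continuous_ae_zero_closure_interior[OF continuous_on_sum_monomials S(1) ae this]
    show "(\<Sum>i\<le>r. \<Sum>j\<le>m i. c i j * s ^ i * t ^ j) = 0"
      by (simp add: vector_2)
  qed
qed

lemma polys_continuous: "p \<in> polys r \<Longrightarrow> continuous_on A p"
proof -
  assume "p \<in> polys r"
  then obtain c where p: "p = (\<lambda>x. \<Sum>i\<le>r. \<Sum>j\<le>r - i. c i j * (x $ 1) ^ i * (x $ 2) ^ j)"
    by (auto simp: polys_def fun_eq_iff)
  show ?thesis
    unfolding p by (rule continuous_on_sum_monomials[where m = "\<lambda>i. r - i"])
qed

lemma polys_isCont: "p \<in> polys r \<Longrightarrow> isCont p x"
  by (rule continuous_on_interior[where S = UNIV, OF polys_continuous]) simp_all

lemma polys_affine_combination: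
  assumes "p \<in> polys r" "q \<in> polys r"
  shows "(\<lambda>x. p x + a * q x) \<in> polys r"
proof -
  obtain c d where c: "\<And>x. p x = (\<Sum>i\<le>r. \<Sum>j\<le>r - i. c i j * (x $ 1) ^ i * (x $ 2) ^ j)"
    and d: "\<And>x. q x = (\<Sum>i\<le>r. \<Sum>j\<le>r - i. d i j * (x $ 1) ^ i * (x $ 2) ^ j)"
    using assms unfolding polys_def by blast
  have "p x + a * q x = (\<Sum>i\<le>r. \<Sum>j\<le>r - i. (c i j + a * d i j) * (x $ 1) ^ i * (x $ 2) ^ j)" for x
    unfolding c d by (simp add: distrib_right sum.distrib sum_distrib_left mult.assoc)
  then show ?thesis
    unfolding polys_def by (intro CollectI exI[of _ "\<lambda>i j. c i j + a * d i j"]) simp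
qed

lemma polys_monomial:
  assumes "i + j \<le> r"
  shows "(\<lambda>x. a * (x $ 1) ^ i * (x $ 2) ^ j) \<in> polys r"
proof -
  let ?c = "\<lambda>i' j'. if i' = i \<and> j' = j then a else 0"
  have eq: "(\<Sum>i'\<le>r. \<Sum>j'\<le>r - i'. ?c i' j' * (x $ 1) ^ i' * (x $ 2) ^ j')
      = a * (x $ 1) ^ i * (x $ 2) ^ j" for x :: "real^2"
  proof -
    have "(\<Sum>j'\<le>r - i'. ?c i' j' * (x $ 1) ^ i' * (x $ 2) ^ j')
        = (if i' = i then a * (x $ 1) ^ i * (x $ 2) ^ j else 0)" for i'
    proof -
      have "(\<Sum>j'\<le>r - i'. ?c i' j' * (x $ 1) ^ i' * (x $ 2) ^ j')
        = (\<Sum>j'\<le>r - i'. if j' = j then if i' = i then a * (x $ 1) ^ i * (x $ 2) ^ j else 0 else 0)"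
        by (intro sum.cong refl) auto
      then show ?thesis using assms by auto
    qed
    then show ?thesis
      using assms by simp
  qed
  show ?thesis
    unfolding polys_def by (intro CollectI exI[of _ ?c] allI eq[symmetric])
qed

lemma polys_const: "(\<lambda>x. a) \<in> polys r"
  using polys_monomial[of 0 0 r a] by simp

text \<open>This is what makes the definite description in \<open>restr\<close> well
  defined.\<close>

lemma polys_unique_ae:
  assumes p: "p \<in> polys r" "q \<in> polys r" and S: "S \<in> sets lebesgue" "interior S \<noteq> {}"
    and ae: "AE x in lebesgue_on S. p x = q x"
  shows "p = q"
proof -
  obtain c where c: "\<And>x. p x + (-1) * q x = (\<Sum>i\<le>r. \<Sum>j\<le>r - i. c i j * (x $ 1) ^ i * (x $ 2) ^ j)"
    using polys_affine_combination[OF p, of "-1"] unfolding polys_def by blast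
  have ae0: "AE x in lebesgue_on S. (\<Sum>i\<le>r. \<Sum>j\<le>r - i. c i j * (x $ 1) ^ i * (x $ 2) ^ j) = 0"
    unfolding c[symmetric] using ae by simp
  have "c i j = 0" if "i \<le> r" "j \<le> r - i" for i j
    using that by (rule coefficients_zero_ae[where m = "\<lambda>i. r - i", OF S ae0])
  then have z: "p x + (-1) * q x = 0" for x
    unfolding c by (intro sum.neutral ballI) simp
  show ?thesis
  proof
    show "p x = q x" for x using z[of x] by linarith
  qed
qed

lemma restr_eqI:
  assumes "p \<in> polys r" "S \<in> sets lebesgue" "interior S \<noteq> {}" "AE x in lebesgue_on S. q x = p x"
  shows "restr r S q = p"
  unfolding restr_def
proof (rule the_equality)
  show "p \<in> polys r \<and> (AE x in lebesgue_on S. q x = p x)" using assms by blast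
  fix p' assume p': "p' \<in> polys r \<and> (AE x in lebesgue_on S. q x = p' x)"
  from conjunct2[OF p'] assms(4) have "AE x in lebesgue_on S. p' x = p x"
    by eventually_elim simp
  with p' show "p' = p"
    using polys_unique_ae assms by blast
qed

section \<open>Triangles in the plane\<close>

text \<open>Twice the signed area of the triangle with vertices \<open>a\<close>, \<open>b\<close>,
  \<open>c\<close>. It is affine in each argument, so barycentric arguments become polynomial
  identities.\<close>

definition cross2 :: "real^2 \<Rightarrow> real^2 \<Rightarrow> real^2 \<Rightarrow> real" where
  "cross2 a b c = (b$1 - a$1) * (c$2 - a$2) - (b$2 - a$2) * (c$1 - a$1)"

lemma collinear_iff_cross2: "collinear {a, b, c} \<longleftrightarrow> cross2 a b c = 0"
proof (cases "a = c")
  case True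
  then show ?thesis by (simp add: collinear_3_expand cross2_def)
next
  case ne: False
  show ?thesis
  proof
    assume "collinear {a, b, c}"
    then obtain u where u: "b = u *\<^sub>R a + (1 - u) *\<^sub>R c"
      using ne unfolding collinear_3_expand by blast
    show "cross2 a b c = 0"
      unfolding u cross2_def by (simp add: algebra_simps)
  next
    assume z: "cross2 a b c = 0"
    \<comment> \<open>The parameter of \<open>b\<close> on the line through \<open>a\<close> and
      \<open>c\<close> is found by division in a coordinate where these two points differ; the
      vanishing area gives the other coordinate.\<close>
    from ne consider "a$1 \<noteq> c$1" | "a$2 \<noteq> c$2"
      by (auto simp: vec_eq_iff forall_2)
    then obtain u where u: "u * (a$1 - c$1) = b$1 - c$1" "u * (a$2 - c$2) = b$2 - c$2"
    proof cases
      case 1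
      have "(b$1 - c$1) * (a$2 - c$2) = (b$2 - c$2) * (a$1 - c$1)"
        using z by (simp add: cross2_def algebra_simps)
      then show ?thesis
        using 1 by (intro that[of "(b$1 - c$1) / (a$1 - c$1)"]) (simp_all add: nonzero_divide_eq_eq)
    next
      case 2
      have "(b$2 - c$2) * (a$1 - c$1) = (b$1 - c$1) * (a$2 - c$2)"
        using z by (simp add: cross2_def algebra_simps)
      then show ?thesis
        using 2 by (intro that[of "(b$2 - c$2) / (a$2 - c$2)"]) (simp_all add: nonzero_divide_eq_eq)
    qed
    then have "b = u *\<^sub>R a + (1 - u) *\<^sub>R c"
      by (simp add: vec_eq_iff forall_2 algebra_simps)
    then show "collinear {a, b, c}"
      unfolding collinear_3_expand by blast
  qed
qed

lemma affine_independent_triangle: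
  "\<not> collinear {a, b, c} \<Longrightarrow> \<not> affine_dependent {a, b, c}"
  by (simp add: collinear_3_eq_affine_dependent)

lemma interior_triangle_nonempty:
  fixes a b c :: "real^2"
  assumes "\<not> collinear {a, b, c}"
  shows "interior (convex hull {a, b, c}) \<noteq> {}"
proof -
  have "a \<noteq> b" "a \<noteq> c" "b \<noteq> c" "\<not> affine_dependent {a, b, c}"
    using assms by (auto simp: collinear_3_eq_affine_dependent)
  then show ?thesis
    by (subst interior_convex_hull_eq_empty) auto
qed

lemma negligible_hull_2: "negligible (convex hull {a, b :: real^2})"
  by (simp add: negligible_convex_interior interior_closed_segment_ge2 flip: segment_convex_hull)

lemma mem_open_segment_imp:
  assumes "m \<in> open_segment a b"
  obtains u where "0 < u" "u < 1" "m = (1 - u) *\<^sub>R a + u *\<^sub>R b"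
  using assms by (auto simp: in_segment)

text \<open>Cutting along \<open>[p, m]\<close> divides the signed area in the ratio given by the
  position of \<open>m\<close>, so both pieces are nondegenerate. Union and intersection come from
  the exchange theorems for affinely independent sets, with \<open>m\<close> as the exchanged point.
  If \<open>m\<close> were on \<open>[p, a]\<close> or \<open>[p, b]\<close>, the corresponding
  piece would be degenerate.\<close>

lemma triangle_split:
  fixes p a b m :: "real^2"
  assumes nc: "\<not> collinear {p, a, b}" and m: "m \<in> open_segment a b"
  shows "\<not> collinear {p, m, a}" "\<not> collinear {p, m, b}"
    and "convex hull {p, a, b} = convex hull {p, m, a} \<union> convex hull {p, m, b}"
    and "convex hull {p, m, a} \<inter> convex hull {p, m, b} = convex hull {p, m}"
    and "m \<notin> convex hull {p, a}" "m \<notin> convex hull {p, b}"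
proof -
  obtain u where u: "0 < u" "u < 1" "m = (1 - u) *\<^sub>R a + u *\<^sub>R b"
    using m by (rule mem_open_segment_imp)
  have "cross2 p m a = - u * cross2 p a b" "cross2 p m b = (1 - u) * cross2 p a b"
    unfolding u(3) cross2_def by (simp_all add: algebra_simps)
  then show nc': "\<not> collinear {p, m, a}" "\<not> collinear {p, m, b}"
    using nc u by (simp_all add: collinear_iff_cross2)
  have mab: "m \<in> convex hull {a, b}"
    using m segment_open_subset_closed unfolding segment_convex_hull[symmetric] by blast
  then have mS: "m \<in> convex hull {p, a, b}"
    using hull_mono[of "{a, b}" "{p, a, b}"] by blast
  show "convex hull {p, m, a} \<inter> convex hull {p, m, b} = convex hull {p, m}"
  proof -
    have "p \<noteq> a" "p \<noteq> b" "a \<noteq> b" using nc by (auto simp: collinear_3_eq_affine_dependent)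
    then have "{p, a} \<inter> {p, b} = {p}" by auto
    then show ?thesis
      using convex_hull_exchange_Int[OF affine_independent_triangle[OF nc] mS, of "{p, a}" "{p, b}"]
      by (simp add: insert_commute)
  qed
  show "convex hull {p, a, b} = convex hull {p, m, a} \<union> convex hull {p, m, b}"
  proof
    show "convex hull {p, m, a} \<union> convex hull {p, m, b} \<subseteq> convex hull {p, a, b}"
      using mS by (intro Un_least hull_minimal) (auto simp: hull_inc)
    have "convex hull {p, a, b} = (\<Union>x\<in>{p, a, b}. convex hull (insert m ({p, a, b} - {x})))"
      by (rule convex_hull_exchange_Union[OF mS])
    also have "\<dots> \<subseteq> convex hull {m, a, b} \<union> convex hull {p, m, b} \<union> convex hull {p, m, a}"
    proof (intro UN_least)
      fix x assume "x \<in> {p, a, b}"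
      then have "insert m ({p, a, b} - {x}) \<subseteq> {m, a, b} \<or> insert m ({p, a, b} - {x}) \<subseteq> {p, m, b}
          \<or> insert m ({p, a, b} - {x}) \<subseteq> {p, m, a}" by auto
      then show "convex hull (insert m ({p, a, b} - {x}))
          \<subseteq> convex hull {m, a, b} \<union> convex hull {p, m, b} \<union> convex hull {p, m, a}"
        by (metis hull_mono le_supI1 le_supI2)
    qed
    \<comment> \<open>The third piece of the exchange is degenerate: it is the edge itself, which
      splits at \<open>m\<close> and is absorbed by the two genuine pieces.\<close>
    also have "convex hull {m, a, b} = convex hull {a, b}"
      using mab by (rule hull_redundant)
    also have "convex hull {a, b} = convex hull {a, m} \<union> convex hull {m, b}"
      using Un_closed_segment[of m a b] mab by (simp add: segment_convex_hull)
    also have "convex hull {a, m} \<subseteq> convex hull {p, m, a}"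
      by (rule hull_mono) auto
    also have "convex hull {m, b} \<subseteq> convex hull {p, m, b}"
      by (rule hull_mono) auto
    finally show "convex hull {p, a, b} \<subseteq> convex hull {p, m, a} \<union> convex hull {p, m, b}"
      by blast
  qed
  have "collinear {p, m, x}" if "m \<in> convex hull {p, x}" for x
  proof -
    have "collinear (convex hull {p, x})"
      by (simp flip: segment_convex_hull)
    moreover have "{p, m, x} \<subseteq> convex hull {p, x}"
      using that by (auto simp: hull_inc)
    ultimately show ?thesis by (rule collinear_subset)
  qed
  then show "m \<notin> convex hull {p, a}" "m \<notin> convex hull {p, b}"
    using nc' by blast+
qed

text \<open>The area of \<open>p b c\<close> relative to that of \<open>a b c\<close> is the
  barycentric coordinate of \<open>p\<close> at \<open>a\<close>, which is positive at interior
  points.\<close>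

lemma interior_point_not_collinear:
  fixes a b c p :: "real^2"
  assumes nc: "\<not> collinear {a, b, c}" and p: "p \<in> interior (convex hull {a, b, c})"
  shows "\<not> collinear {p, b, c}"
proof -
  obtain x y w where xyz: "0 < x" "0 < y" "0 < w" "x + y + w = 1"
    and p: "x *\<^sub>R a + y *\<^sub>R b + w *\<^sub>R c = p"
    using p unfolding interior_convex_hull_3_minimal[OF nc, simplified] by auto
  have "cross2 p b c = x * cross2 a b c"
  proof -
    have x: "x = 1 - y - w" using xyz by simp
    show ?thesis
      unfolding p[symmetric] x cross2_def by (simp add: algebra_simps)
  qed
  then show ?thesis
    using nc xyz by (simp add: collinear_iff_cross2)
qed

text \<open>In the plane, two unit vectors orthogonal to the same nonzero vector agree up to sign,
  and the strict inequality fixes the sign.\<close>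

lemma outward_normal_eqI:
  assumes "a \<noteq> b" and m: "norm m = 1" "m \<bullet> (b - a) = 0" "m \<bullet> (c - a) < 0"
  shows "outward_normal a b c = m"
  unfolding outward_normal_def
proof (rule the_equality)
  show "norm m = 1 \<and> m \<bullet> (b - a) = 0 \<and> m \<bullet> (c - a) < 0" using m by blast
next
  fix n assume n: "norm n = 1 \<and> n \<bullet> (b - a) = 0 \<and> n \<bullet> (c - a) < 0"
  define d where "d = b - a"
  have d: "d$1 \<noteq> 0 \<or> d$2 \<noteq> 0"
    using assms(1) by (auto simp: d_def vec_eq_iff forall_2)
  have e: "m$1 * d$1 + m$2 * d$2 = 0" "n$1 * d$1 + n$2 * d$2 = 0"
    using m n by (simp_all add: d_def inner_vec_def sum_2)
  have "(m$1 * n$2 - m$2 * n$1) * d$1 = 0" "(m$1 * n$2 - m$2 * n$1) * d$2 = 0"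
    using e by algebra+
  with d have cr: "m$1 * n$2 - m$2 * n$1 = 0" by auto
  have "m \<bullet> m = 1" "n \<bullet> n = 1"
    using m n by (simp_all add: dot_square_norm)
  then have 1: "m$1 * m$1 + m$2 * m$2 = 1" "n$1 * n$1 + n$2 * n$2 = 1"
    by (simp_all add: inner_vec_def sum_2)
  \<comment> \<open>Lagrange's identity: the squares of the inner product and of the planar cross
    product add up to the product of the squared norms.\<close>
  then have "(m$1 * n$1 + m$2 * n$2)\<^sup>2 = 1"
    using cr by algebra
  then consider "m \<bullet> n = 1" | "m \<bullet> n = - 1"
    by (auto simp: inner_vec_def sum_2 power2_eq_1_iff)
  then show "n = m"
  proof cases
    case 1
    then have "(n - m) \<bullet> (n - m) = 0"
      using \<open>m \<bullet> m = 1\<close> \<open>n \<bullet> n = 1\<close> by (simp add: inner_diff inner_commute)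
    then show ?thesis by simp
  next
    case 2
    then have "(n + m) \<bullet> (n + m) = 0"
      using \<open>m \<bullet> m = 1\<close> \<open>n \<bullet> n = 1\<close> by (simp add: inner_add inner_commute)
    then have "n = - m" by (simp add: eq_neg_iff_add_eq_0)
    then show ?thesis using m n by simp
  qed
qed

lemma outward_normal_props:
  assumes nc: "\<not> collinear {a, b, c}"
  shows "norm (outward_normal a b c) = 1" "outward_normal a b c \<bullet> (b - a) = 0"
    "outward_normal a b c \<bullet> (c - a) < 0"
proof -
  have ab: "a \<noteq> b" using nc by (auto simp: collinear_3_eq_affine_dependent)
  \<comment> \<open>The edge vector turned by a quarter; its inner product with \<open>c - a\<close>
    is the signed area, whose sign then decides the orientation of \<open>m\<close>.\<close>
  define w :: "real^2" where "w = vector [- (b - a)$2, (b - a)$1]"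
  have w: "w \<bullet> (b - a) = 0" "w \<bullet> (c - a) = cross2 a b c"
    by (simp_all add: w_def inner_vec_def sum_2 vector_2 cross2_def algebra_simps)
  have "w \<noteq> 0"
    using ab by (auto simp: w_def vec_eq_iff forall_2 vector_2)
  define m where "m = (- sgn (cross2 a b c) / norm w) *\<^sub>R w"
  have c0: "cross2 a b c \<noteq> 0" using nc by (simp add: collinear_iff_cross2)
  have m: "norm m = 1" "m \<bullet> (b - a) = 0" "m \<bullet> (c - a) < 0"
  proof -
    show "norm m = 1" using c0 \<open>w \<noteq> 0\<close> by (simp add: m_def sgn_if)
    show "m \<bullet> (b - a) = 0" using w by (simp add: m_def)
    have "m \<bullet> (c - a) = - \<bar>cross2 a b c\<bar> / norm w"
      using w by (simp add: m_def abs_sgn mult.commute)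
    then show "m \<bullet> (c - a) < 0" using c0 \<open>w \<noteq> 0\<close> by simp
  qed
  with outward_normal_eqI[OF ab m]
  show "norm (outward_normal a b c) = 1" "outward_normal a b c \<bullet> (b - a) = 0"
    "outward_normal a b c \<bullet> (c - a) < 0" by simp_all
qed

text \<open>The vector \<open>m - p\<close> is a convex combination of \<open>a - p\<close> and
  \<open>b - p\<close> with positive weights. Its inner product with the normal is 0, so the inner
  products with the other two have opposite signs.\<close>

lemma outward_normal_opposite:
  assumes nc: "\<not> collinear {p, m, a}" and m: "m \<in> open_segment a b"
  shows "outward_normal p m b = - outward_normal p m a"
proof (rule outward_normal_eqI)
  let ?n = "outward_normal p m a"
  note n = outward_normal_props[OF nc]
  show "p \<noteq> m" using nc by auto
  show "norm (- ?n) = 1" "- ?n \<bullet> (m - p) = 0" using n by simp_all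
  obtain u where u: "0 < u" "u < 1" "m = (1 - u) *\<^sub>R a + u *\<^sub>R b"
    using m by (rule mem_open_segment_imp)
  have "m - p = (1 - u) *\<^sub>R (a - p) + u *\<^sub>R (b - p)"
    unfolding u(3) by (simp add: algebra_simps)
  then have "(1 - u) * (?n \<bullet> (a - p)) + u * (?n \<bullet> (b - p)) = 0"
    using n(2) by (simp add: inner_add_right)
  moreover have "(1 - u) * (?n \<bullet> (a - p)) < 0"
    using n(3) u by (simp add: mult_pos_neg)
  ultimately have "0 < u * (?n \<bullet> (b - p))" by linarith
  then show "- ?n \<bullet> (b - p) < 0"
    using u by (simp add: zero_less_mult_iff)
qed

section \<open>The six triangles of the split\<close>

text \<open>Pairs rather than sets index the six triangles, so that sums over triangles do not
  require the sets to be shown distinct first.\<close>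

definition ps_index :: "(nat \<times> nat) set" where
  "ps_index = {(i, j). i \<in> {1..3} \<and> j \<in> {1..3} \<and> i \<noteq> j}"

lemma index_set: "{1..3::nat} = {1, 2, 3}"
  by auto

lemma ps_index_eq: "ps_index = {(1,2), (1,3), (2,1), (2,3), (3,1), (3,2)}"
  unfolding ps_index_def index_set by auto

lemma finite_ps_index: "finite ps_index"
  and card_ps_index: "card ps_index = 6"
  by (simp_all add: ps_index_eq)

lemma nxt_simps: "nxt 1 = 2" "nxt (Suc 0) = 2" "nxt 2 = 3" "nxt 3 = 1"
  by (simp_all add: nxt_def)

lemma nxt_index:
  assumes "i \<in> {1..3}"
  shows "nxt i \<in> {1..3}" "nxt (nxt i) \<in> {1..3}" "nxt i \<noteq> i" "nxt (nxt i) \<noteq> i"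
    "nxt i \<noteq> nxt (nxt i)" "{1..3} = {i, nxt i, nxt (nxt i)}"
  using assms unfolding index_set by (auto simp: nxt_simps)

locale ps_config =
  fixes z :: "nat \<Rightarrow> real^2"
  assumes powell_sabin: "powell_sabin z"
begin

text \<open>The coarser split into three triangles, one over each full edge. The exchange theorems
  apply to it directly, and each sector is then cut in two by \<open>triangle_split\<close>.\<close>

definition sector :: "nat \<Rightarrow> (real^2) set" where
  "sector i = convex hull {z 0, z (nxt i), z (nxt (nxt i))}"

abbreviation tri :: "nat \<times> nat \<Rightarrow> (real^2) set" where
  "tri s \<equiv> ps_triangle z (fst s) (snd s)"

lemma ps_split_eq: "ps_split z = tri ` ps_index"
  unfolding ps_split_def ps_index_def by force

lemma vertices_not_collinear: "\<not> collinear {z 1, z 2, z 3}"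
  using powell_sabin by (simp add: powell_sabin_def collinear_iff_cross2 cross2_def det_2 vector_2)

lemma vertices_eq:
  assumes "i \<in> {1..3}" shows "{z 1, z 2, z 3} = {z i, z (nxt i), z (nxt (nxt i))}"
  using assms unfolding index_set by (auto simp: nxt_simps)

lemma inj_z: "inj_on z {1..3}"
proof -
  have "z 1 \<noteq> z 2" "z 1 \<noteq> z 3" "z 2 \<noteq> z 3"
    using vertices_not_collinear by (auto simp: collinear_3_eq_affine_dependent)
  then show ?thesis unfolding index_set by auto
qed

lemma center_in_triangle: "z 0 \<in> convex hull {z 1, z 2, z 3}"
  using powell_sabin interior_subset by (auto simp: powell_sabin_def big_triangle_def)

lemma edge_point:
  "i \<in> {1..3} \<Longrightarrow> z (3 + i) \<in> open_segment (z (nxt i)) (z (nxt (nxt i)))"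
  using powell_sabin by (simp add: powell_sabin_def)

lemma sector_not_collinear:
  assumes i: "i \<in> {1..3}" shows "\<not> collinear {z 0, z (nxt i), z (nxt (nxt i))}"
proof (rule interior_point_not_collinear)
  show "\<not> collinear {z i, z (nxt i), z (nxt (nxt i))}"
    using vertices_not_collinear unfolding vertices_eq[OF i] .
  show "z 0 \<in> interior (convex hull {z i, z (nxt i), z (nxt (nxt i))})"
    using powell_sabin unfolding powell_sabin_def big_triangle_def vertices_eq[OF i] by blast
qed

lemmas sector_split = triangle_split[OF sector_not_collinear edge_point]

lemma sector_eq_exchange:
  assumes "i \<in> {1..3}" shows "sector i = convex hull (insert (z 0) (z ` ({1..3} - {i})))"
proof -
  have "{1..3} - {i} = {nxt i, nxt (nxt i)}"
    using nxt_index[OF assms] by auto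
  then show ?thesis by (simp add: sector_def)
qed

text \<open>Exchanging vertices of an affinely independent set for \<open>z 0\<close> makes
  intersections of hulls the hulls of the common points, and two different sectors share just one
  vertex besides \<open>z 0\<close>.\<close>

lemma sector_Int:
  assumes "i \<in> {1..3}" "i' \<in> {1..3}" "i \<noteq> i'"
  obtains k where "k \<in> {1..3}" "k \<noteq> i" "k \<noteq> i'" "sector i \<inter> sector i' = convex hull {z 0, z k}"
proof -
  have img: "z ` {1..3} = {z 1, z 2, z 3}"
  unfolding index_set by simp
  have "\<exists>k\<in>{1..3}. k \<noteq> i \<and> k \<noteq> i' \<and> ({1..3} - {i}) \<inter> ({1..3} - {i'}) = {k}"
    using assms unfolding index_set by auto
  then obtain k where k: "k \<in> {1..3}" "k \<noteq> i" "k \<noteq> i'" "({1..3} - {i}) \<inter> ({1..3} - {i'}) = {k}"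
    by blast
  have "sector i \<inter> sector i'
      = convex hull (insert (z 0) (z ` ({1..3} - {i}) \<inter> z ` ({1..3} - {i'})))"
    unfolding sector_eq_exchange[OF assms(1)] sector_eq_exchange[OF assms(2)]
    using affine_independent_triangle[OF vertices_not_collinear] center_in_triangle
    unfolding img[symmetric] by (rule convex_hull_exchange_Int) auto
  also have "z ` ({1..3} - {i}) \<inter> z ` ({1..3} - {i'}) = {z k}"
    using inj_on_image_Int[OF inj_z, of "{1..3} - {i}" "{1..3} - {i'}"] k(4) by auto
  finally show ?thesis
    using that k by blast
qed

lemma ps_index_cases:
  assumes "s \<in> ps_index"
  shows "fst s \<in> {1..3}" "s = (fst s, nxt (fst s)) \<or> s = (fst s, nxt (nxt (fst s)))"
  using assms unfolding ps_index_eq index_set by (auto simp: nxt_simps)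

lemma tri_not_collinear:
  assumes "s \<in> ps_index" shows "\<not> collinear {z 0, z (3 + fst s), z (snd s)}"
proof -
  have "snd s = nxt (fst s) \<or> snd s = nxt (nxt (fst s))"
    using ps_index_cases(2)[OF assms] by (metis snd_conv)
  then show ?thesis
    using sector_split(1,2)[OF ps_index_cases(1,1)[OF assms]] by (elim disjE) simp_all
qed

lemma interior_tri: "s \<in> ps_index \<Longrightarrow> interior (tri s) \<noteq> {}"
  unfolding ps_triangle_def by (rule interior_triangle_nonempty[OF tri_not_collinear])

lemma compact_tri: "compact (tri s)"
  unfolding ps_triangle_def by (intro compact_convex_hull finite_imp_compact) auto

lemma tri_sets [simp]: "tri s \<in> sets lebesgue"
  using compact_tri by (intro lmeasurable_compact[THEN fmeasurableD])

lemma closure_interior_tri: "s \<in> ps_index \<Longrightarrow> closure (interior (tri s)) = tri s"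
  using convex_closure_interior[OF _ interior_tri] compact_tri[of s]
  by (simp add: ps_triangle_def convex_convex_hull compact_imp_closed)

lemma edge_point_in_tri: "z (3 + fst s) \<in> tri s"
  by (simp add: ps_triangle_def hull_inc)

lemma sector_eq_tri:
  "i \<in> {1..3} \<Longrightarrow> sector i = tri (i, nxt i) \<union> tri (i, nxt (nxt i))"
  using sector_split(3)[of i] by (simp add: sector_def ps_triangle_def)

lemma tri_subset_sector:
  assumes "s \<in> ps_index" shows "tri s \<subseteq> sector (fst s)"
  unfolding sector_eq_tri[OF ps_index_cases(1)[OF assms]]
  using ps_index_cases(2)[OF assms] by (metis Un_upper1 Un_upper2)

lemma nxt_ps_index: "i \<in> {1..3} \<Longrightarrow> (i, nxt i) \<in> ps_index \<and> (i, nxt (nxt i)) \<in> ps_index"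
  using nxt_index[of i] by (auto simp: ps_index_def)

lemma big_triangle_eq: "big_triangle z = (\<Union>s\<in>ps_index. tri s)"
proof -
  have "big_triangle z = sector 1 \<union> sector 2 \<union> sector 3"
  proof -
    have ne: "z 1 \<noteq> z 2" "z 1 \<noteq> z 3" "z 2 \<noteq> z 3"
      using vertices_not_collinear by (auto simp: collinear_3_eq_affine_dependent)
    have "{z 1, z 2, z 3} - {z 1} = {z 2, z 3}" "{z 1, z 2, z 3} - {z 2} = {z 3, z 1}"
      "{z 1, z 2, z 3} - {z 3} = {z 1, z 2}"
      using ne by auto
    then show ?thesis
      unfolding big_triangle_def convex_hull_exchange_Union[OF center_in_triangle]
      by (simp add: sector_def nxt_simps Un_assoc)
  qed
  then show ?thesis
    by (simp add: sector_eq_tri nxt_simps ps_index_eq Un_ac)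
qed

text \<open>Two triangles in one sector meet in the cutting segment. Triangles in different sectors
  meet inside a segment from \<open>z 0\<close> to a common vertex.\<close>

lemma negligible_tri_Int:
  assumes s: "s \<in> ps_index" "t \<in> ps_index" "s \<noteq> t"
  shows "negligible (tri s \<inter> tri t)"
proof (cases "fst s = fst t")
  case True
  define i where "i = fst s"
  have i: "i \<in> {1..3}" using ps_index_cases(1)[OF s(1)] by (simp add: i_def)
  have "s = (i, nxt i) \<or> s = (i, nxt (nxt i))" "t = (i, nxt i) \<or> t = (i, nxt (nxt i))"
    using ps_index_cases(2)[OF s(1)] ps_index_cases(2)[OF s(2)] True by (simp_all only: i_def)
  with s(3) have "tri s \<inter> tri t = tri (i, nxt i) \<inter> tri (i, nxt (nxt i))"
    by (metis Int_commute)
  also have "\<dots> = convex hull {z 0, z (3 + i)}"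
    using sector_split(4)[OF i i] by (simp add: ps_triangle_def)
  finally show ?thesis by (simp only: negligible_hull_2)
next
  case False
  obtain k where "sector (fst s) \<inter> sector (fst t) = convex hull {z 0, z k}"
    using sector_Int[OF ps_index_cases(1)[OF s(1)] ps_index_cases(1)[OF s(2)] False] by blast
  then have "tri s \<inter> tri t \<subseteq> convex hull {z 0, z k}"
    using tri_subset_sector[OF s(1)] tri_subset_sector[OF s(2)] by blast
  then show ?thesis
    using negligible_hull_2 negligible_subset by blast
qed

text \<open>Otherwise the point would lie in two sectors, hence on a segment from \<open>z 0\<close>
  to an endpoint of its own edge, which \<open>triangle_split\<close> excludes. This separates
  \<open>z (3 + i)\<close> from the four triangles of the other sectors.\<close>

lemma edge_point_notin_tri:
  assumes i: "i \<in> {1..3}" and s: "s \<in> ps_index" "fst s \<noteq> i"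
  shows "z (3 + i) \<notin> tri s"
proof
  assume "z (3 + i) \<in> tri s"
  then have "z (3 + i) \<in> sector i \<inter> sector (fst s)"
    using tri_subset_sector[OF s(1)] sector_eq_tri[OF i] edge_point_in_tri[of "(i, nxt i)"]
    by (simp add: subset_iff)
  moreover obtain k where k: "k \<in> {1..3}" "k \<noteq> i"
    and "sector i \<inter> sector (fst s) = convex hull {z 0, z k}"
    using sector_Int[OF i ps_index_cases(1)[OF s(1)] s(2)[symmetric]] by blast
  ultimately have "z (3 + i) \<in> convex hull {z 0, z k}" by simp
  moreover have "k = nxt i \<or> k = nxt (nxt i)"
    using nxt_index(6)[OF i] k by blast
  ultimately show False
    using sector_split(5,6)[OF i i] by metis
qed

lemma ps_normal_props:
  assumes i: "i \<in> {1..3}"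
  shows "ps_normal z i (nxt i) \<bullet> ps_normal z i (nxt i) = 1"
    "ps_normal z i (nxt (nxt i)) = - ps_normal z i (nxt i)"
proof -
  show "ps_normal z i (nxt i) \<bullet> ps_normal z i (nxt i) = 1"
    unfolding ps_normal_def using outward_normal_props(1)[OF sector_split(1)[OF i i]]
    by (simp add: dot_square_norm)
  show "ps_normal z i (nxt (nxt i)) = - ps_normal z i (nxt i)"
    unfolding ps_normal_def by (rule outward_normal_opposite[OF sector_split(1)[OF i i] edge_point[OF i]])
qed

text \<open>The two normals are opposite unit vectors, so the component along the first is the plain
  difference of the two traces.\<close>

lemma jump_dof_eq:
  assumes "i \<in> {1..3}"
  shows "jump_dof r z i q =
    restr r (tri (i, nxt i)) q (z (3 + i)) - restr r (tri (i, nxt (nxt i))) q (z (3 + i))"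
  using ps_normal_props[OF assms]
  by (simp add: jump_dof_def jump_def Let_def inner_add_left algebra_simps)

end

section \<open>Square-integrable piecewise polynomials\<close>

text \<open>Since \<open>g\<close> is continuous only at \<open>y\<close>, agreement cannot be
  extended to the whole interior. However, every neighbourhood of \<open>y\<close> meets
  \<open>interior S\<close> in a nonempty open set, which has positive measure and so contains a
  point of agreement; a sequence of such points gives the limit.\<close>

lemma closure_interior_ae_eq_at:
  fixes g p :: "'a::euclidean_space \<Rightarrow> real"
  assumes S: "S \<in> sets lebesgue" and y: "y \<in> closure (interior S)"
    and g: "continuous (at y within S) g" and p: "continuous_on UNIV p"
    and ae: "AE x in lebesgue_on S. g x = p x"
  shows "g y = p y"
proof -
  let ?E = "{x \<in> interior S. g x = p x}"
  have "y \<in> closure ?E"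
    unfolding closure_iff_nhds_not_empty
  proof (intro allI impI)
    fix A U assume U: "U \<subseteq> A" "open U" "y \<in> U"
    have "U \<inter> interior S \<noteq> {}"
      using y U(2,3) open_Int_closure_eq_empty by blast
    then have "\<not> negligible (U \<inter> interior S)"
      using U(2) by (intro open_not_negligible) auto
    moreover have "negligible (U \<inter> interior S)" if "?E \<inter> A = {}"
    proof -
      have "AE x in lebesgue. x \<notin> U \<inter> interior S"
        using ae that U(1) interior_subset[of S] unfolding AE_lebesgue_on_iff[OF S]
        by (auto elim!: eventually_mono)
      then show ?thesis
        using U(2) by (simp add: negligible_iff_null_sets AE_iff_null_sets borel_open)
    qed
    ultimately show "?E \<inter> A \<noteq> {}" by blast
  qed
  then obtain X where X: "\<And>n. X n \<in> ?E" "X \<longlonglongrightarrow> y"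
    unfolding closure_sequential by blast
  have "(\<lambda>n. g (X n)) \<longlonglongrightarrow> g y"
    using g X interior_subset unfolding continuous_within_sequentially comp_def by blast
  moreover have "(\<lambda>n. p (X n)) \<longlonglongrightarrow> p y"
    using p X(2) by (auto simp: continuous_on_eq_continuous_at intro: isCont_tendsto_compose)
  moreover have "g (X n) = p (X n)" for n using X(1)[of n] by simp
  ultimately show ?thesis
    by (simp add: LIMSEQ_unique)
qed

lemma L2_onD:
  assumes "q \<in> L2_on T"
  shows "q \<in> borel_measurable (lebesgue_on T)" "integrable (lebesgue_on T) (\<lambda>x. (q x)\<^sup>2)"
  using assms by (simp_all add: L2_on_def)

lemma integrable_L2_mult:
  assumes u: "u \<in> L2_on T" and v: "v \<in> L2_on T"
  shows "integrable (lebesgue_on T) (\<lambda>x. u x * v x)"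
proof (rule Bochner_Integration.integrable_bound)
  show "integrable (lebesgue_on T) (\<lambda>x. (u x)\<^sup>2 + (v x)\<^sup>2)"
    using L2_onD(2)[OF u] L2_onD(2)[OF v] by simp
  show "(\<lambda>x. u x * v x) \<in> borel_measurable (lebesgue_on T)"
    using L2_onD(1)[OF u] L2_onD(1)[OF v] by (rule borel_measurable_times)
  have "\<bar>a * b\<bar> \<le> a\<^sup>2 + b\<^sup>2" for a b :: real
  proof -
    have "0 \<le> \<bar>a\<bar> * \<bar>b\<bar>" by simp
    then show ?thesis
      using sum_squares_bound[of "\<bar>a\<bar>" "\<bar>b\<bar>"] unfolding abs_mult power2_abs by linarith
  qed
  then show "AE x in lebesgue_on T. norm (u x * v x) \<le> norm ((u x)\<^sup>2 + (v x)\<^sup>2)"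
    by (intro AE_I2) (auto intro: order_trans[OF _ abs_ge_self])
qed

lemma L2_on_bounded:
  assumes T: "T \<in> lmeasurable" and q: "q \<in> borel_measurable (lebesgue_on T)"
    and B: "\<And>x. x \<in> T \<Longrightarrow> \<bar>q x\<bar> \<le> B"
  shows "q \<in> L2_on T"
proof -
  interpret finite_measure "lebesgue_on T" using T by (rule finite_measure_lebesgue_on)
  have "integrable (lebesgue_on T) (\<lambda>x. (q x)\<^sup>2)"
  proof (rule integrable_const_bound)
    have "(q x)\<^sup>2 \<le> B\<^sup>2" if "x \<in> T" for x
      using B[OF that] by (rule abs_le_square_iff[THEN iffD1, OF order_trans[OF _ abs_ge_self]])
    then show "AE x in lebesgue_on T. norm ((q x)\<^sup>2) \<le> B\<^sup>2"
      by (intro AE_I2) (simp add: space_restrict_space)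
    show "(\<lambda>x. (q x)\<^sup>2) \<in> borel_measurable (lebesgue_on T)"
      using q by (rule borel_measurable_power)
  qed
  then show ?thesis using q by (simp add: L2_on_def)
qed

lemma function_space_L2_on: "function_space (L2_on T)"
  unfolding function_space_def
proof (intro conjI ballI allI)
  show "(\<lambda>x. 0) \<in> L2_on T" by (simp add: L2_on_def)
  fix u v and a :: real assume u: "u \<in> L2_on T" and v: "v \<in> L2_on T"
  have "(\<lambda>x. u x + a * v x) \<in> borel_measurable (lebesgue_on T)"
    using L2_onD(1)[OF u] L2_onD(1)[OF v]
    by (intro borel_measurable_add borel_measurable_times borel_measurable_const)
  moreover have "integrable (lebesgue_on T) (\<lambda>x. (u x)\<^sup>2 + (2 * a) * (u x * v x) + a\<^sup>2 * (v x)\<^sup>2)"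
    using L2_onD(2)[OF u] L2_onD(2)[OF v] integrable_L2_mult[OF u v] by simp
  moreover have "(\<lambda>x. (u x)\<^sup>2 + (2 * a) * (u x * v x) + a\<^sup>2 * (v x)\<^sup>2) = (\<lambda>x. (u x + a * v x)\<^sup>2)"
    by (simp add: power2_sum power_mult_distrib ac_simps)
  ultimately show "(\<lambda>x. u x + a * v x) \<in> L2_on T" by (simp add: L2_on_def)
qed

lemma integrable_L2_on:
  assumes T: "T \<in> lmeasurable" and u: "u \<in> L2_on T"
  shows "integrable (lebesgue_on T) u"
proof -
  have "(\<lambda>x. 1) \<in> L2_on T"
    using T by (intro L2_on_bounded[where B = 1]) auto
  from integrable_L2_mult[OF u this] show ?thesis by simp
qed

text \<open>Counts the monomials of degree at most \<open>r\<close>, doubled to avoid a division.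
  Six copies then give \<open>3 * (r + 1) * (r + 2)\<close>.\<close>

lemma card_triangular_index: "2 * card (SIGMA i:{..r}. {..r - i}) = (r + 1) * (r + 2)"
proof -
  have "2 * (\<Sum>i\<le>r. Suc (r - i)) = (r + 1) * (r + 2)"
  proof (induction r)
    case 0
    then show ?case by simp
  next
    case (Suc r)
    \<comment> \<open>Splitting off the index 0 instead of the top index leaves exactly the sum for
      \<open>r\<close>.\<close>
    then show ?case by (simp add: sum.atMost_Suc_shift del: sum.atMost_Suc)
  qed
  then show ?thesis by simp
qed

section \<open>Piecewise polynomials on the split as a space modulo null sets\<close>

context ps_config
begin

abbreviation T :: "(real^2) set" where
  "T \<equiv> big_triangle z"

lemma T_compact: "compact T"
  unfolding big_triangle_def by (intro compact_convex_hull finite_imp_compact) auto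

lemma T_lmeasurable: "T \<in> lmeasurable"
  using T_compact by (rule lmeasurable_compact)

lemma T_sets [simp]: "T \<in> sets lebesgue"
  using T_lmeasurable by (rule fmeasurableD)

lemma tri_subset_T: "s \<in> ps_index \<Longrightarrow> tri s \<subseteq> T"
  unfolding big_triangle_eq by blast

lemma AE_tri: "s \<in> ps_index \<Longrightarrow> AE x in lebesgue_on T. P x \<Longrightarrow> AE x in lebesgue_on (tri s). P x"
  by (rule AE_lebesgue_on_mono[OF _ tri_subset_T]) auto

lemma AE_T_iff:
  "(AE x in lebesgue_on T. P x) \<longleftrightarrow> (\<forall>s\<in>ps_index. AE x in lebesgue_on (tri s). P x)"
proof
  assume "\<forall>s\<in>ps_index. AE x in lebesgue_on (tri s). P x"
  then have "\<forall>s\<in>ps_index. AE x in lebesgue. x \<in> tri s \<longrightarrow> P x"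
    by (simp add: AE_lebesgue_on_iff)
  then have "AE x in lebesgue. \<forall>s\<in>ps_index. x \<in> tri s \<longrightarrow> P x"
    by (rule eventually_ball_finite[OF finite_ps_index])
  then show "AE x in lebesgue_on T. P x"
    unfolding AE_lebesgue_on_iff[OF T_sets] by eventually_elim (auto simp: big_triangle_eq)
qed (use AE_tri in blast)

lemma V2_iff:
  "q \<in> V2 r z \<longleftrightarrow> q \<in> L2_on T \<and>
     (\<forall>s\<in>ps_index. \<exists>p\<in>polys r. AE x in lebesgue_on (tri s). q x = p x)"
  by (simp add: V2_def ps_split_eq)

lemma V2_L2: "q \<in> V2 r z \<Longrightarrow> q \<in> L2_on T"
  by (simp add: V2_iff)

lemma restr_tri_eqI:
  "\<lbrakk>s \<in> ps_index; p \<in> polys r; AE x in lebesgue_on (tri s). q x = p x\<rbrakk> \<Longrightarrow> restr r (tri s) q = p"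
  by (intro restr_eqI interior_tri) auto

lemma restr_tri:
  assumes "q \<in> V2 r z" "s \<in> ps_index"
  shows "restr r (tri s) q \<in> polys r" "AE x in lebesgue_on (tri s). q x = restr r (tri s) q x"
proof -
  obtain p where p: "p \<in> polys r" "AE x in lebesgue_on (tri s). q x = p x"
    using assms unfolding V2_iff by blast
  then have "restr r (tri s) q = p"
    by (rule restr_tri_eqI[OF assms(2)])
  with p show "restr r (tri s) q \<in> polys r" "AE x in lebesgue_on (tri s). q x = restr r (tri s) q x"
    by simp_all
qed

lemma restr_lincomb_ae:
  assumes "u \<in> V2 r z" "v \<in> V2 r z" "s \<in> ps_index"
  shows "AE x in lebesgue_on (tri s). u x + a * v x = restr r (tri s) u x + a * restr r (tri s) v x"
  using restr_tri(2)[OF assms(1,3)] restr_tri(2)[OF assms(2,3)] by eventually_elim simp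

lemma restr_lincomb:
  assumes "u \<in> V2 r z" "v \<in> V2 r z" "s \<in> ps_index"
  shows "restr r (tri s) (\<lambda>x. u x + a * v x) = (\<lambda>x. restr r (tri s) u x + a * restr r (tri s) v x)"
  by (intro restr_tri_eqI polys_affine_combination restr_tri restr_lincomb_ae assms)

lemma restr_cong_ae:
  assumes "u \<in> V2 r z" "v \<in> V2 r z" "s \<in> ps_index" "AE x in lebesgue_on T. u x = v x"
  shows "restr r (tri s) u = restr r (tri s) v"
proof (rule restr_tri_eqI[OF assms(3) restr_tri(1)[OF assms(2,3)]])
  show "AE x in lebesgue_on (tri s). u x = restr r (tri s) v x"
    using AE_tri[OF assms(3,4)] restr_tri(2)[OF assms(2,3)] by eventually_elim simp
qed

lemma function_space_V2: "function_space (V2 r z)"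
  unfolding function_space_def
proof (intro conjI ballI allI)
  show "(\<lambda>x. 0) \<in> V2 r z"
    using function_spaceD(1)[OF function_space_L2_on] by (auto simp: V2_iff intro!: bexI[OF _ polys_const[of 0]])
  fix u v a assume uv: "u \<in> V2 r z" "v \<in> V2 r z"
  show "(\<lambda>x. u x + a * v x) \<in> V2 r z"
    unfolding V2_iff
  proof (intro conjI ballI)
    show "(\<lambda>x. u x + a * v x) \<in> L2_on T"
      using uv by (intro function_spaceD(2)[OF function_space_L2_on] V2_L2)
    fix s assume s: "s \<in> ps_index"
    show "\<exists>p\<in>polys r. AE x in lebesgue_on (tri s). u x + a * v x = p x"
      by (rule bexI[where x = "\<lambda>x. restr r (tri s) u x + a * restr r (tri s) v x"])
        (intro restr_lincomb_ae polys_affine_combination restr_tri uv s)+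
  qed
qed

text \<open>By uniqueness of the polynomial on each triangle, \<open>restr\<close> is linear on
  \<open>V2 r z\<close> and depends only on the class, and the jump inherits both
  properties.\<close>

lemma ae_functional_jump_dof:
  assumes "i \<in> {1..3}" shows "ae_functional T (V2 r z) (jump_dof r z i)"
proof -
  have s: "(i, nxt i) \<in> ps_index" "(i, nxt (nxt i)) \<in> ps_index"
    using nxt_ps_index[OF assms] by blast+
  show ?thesis
    unfolding ae_functional_def jump_dof_eq[OF assms]
  proof (intro conjI ballI allI impI)
    fix u v a assume uv: "u \<in> V2 r z" "v \<in> V2 r z"
    let ?R = "\<lambda>j w. restr r (tri (i, j)) w (z (3 + i))"
    show "?R (nxt i) (\<lambda>x. u x + a * v x) - ?R (nxt (nxt i)) (\<lambda>x. u x + a * v x)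
        = ?R (nxt i) u - ?R (nxt (nxt i)) u + a * (?R (nxt i) v - ?R (nxt (nxt i)) v)"
      unfolding restr_lincomb[OF uv s(1)] restr_lincomb[OF uv s(2)] by (simp add: algebra_simps)
    assume ae: "AE x in lebesgue_on T. u x = v x"
    show "?R (nxt i) u - ?R (nxt (nxt i)) u = ?R (nxt i) v - ?R (nxt (nxt i)) v"
      unfolding restr_cong_ae[OF uv s(1) ae] restr_cong_ae[OF uv s(2) ae] ..
  qed
qed

lemma ae_functional_integral: "ae_functional T (V2 r z) (integral\<^sup>L (lebesgue_on T))"
  unfolding ae_functional_def
proof (intro conjI ballI allI impI)
  fix u v and a :: real assume uv: "u \<in> V2 r z" "v \<in> V2 r z"
  then have int: "integrable (lebesgue_on T) u" "integrable (lebesgue_on T) v"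
    by (auto intro!: integrable_L2_on T_lmeasurable V2_L2)
  then show "(LINT x|lebesgue_on T. u x + a * v x) = integral\<^sup>L (lebesgue_on T) u + a * integral\<^sup>L (lebesgue_on T) v"
    by simp
  assume "AE x in lebesgue_on T. u x = v x"
  with int show "integral\<^sup>L (lebesgue_on T) u = integral\<^sup>L (lebesgue_on T) v"
    by (intro integral_cong_AE) auto
qed

text \<open>On shared edges the contributions of several triangles add up. Only the values off these
  null sets are meant, and \<open>piecewise_ae\<close> recovers each piece almost
  everywhere.\<close>

definition piecewise :: "(nat \<times> nat \<Rightarrow> real^2 \<Rightarrow> real) \<Rightarrow> real^2 \<Rightarrow> real" where
  "piecewise p x = (\<Sum>s\<in>ps_index. indicator (tri s) x * p s x)"

lemma AE_tri_disjoint: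
  assumes "s \<in> ps_index"
  shows "AE x in lebesgue_on (tri s). \<forall>t\<in>ps_index. t \<noteq> s \<longrightarrow> x \<notin> tri t"
proof (rule eventually_ball_finite[OF finite_ps_index], intro ballI)
  fix t assume t: "t \<in> ps_index"
  show "AE x in lebesgue_on (tri s). t \<noteq> s \<longrightarrow> x \<notin> tri t"
  proof (cases "t = s")
    case False
    then have "tri s \<inter> tri t \<in> null_sets lebesgue"
      using negligible_tri_Int[OF assms t] by (simp add: negligible_iff_null_sets)
    then show ?thesis
      unfolding AE_lebesgue_on_iff[OF tri_sets] by (auto dest: AE_not_in elim!: eventually_mono)
  qed simp
qed

lemma piecewise_ae:
  assumes s: "s \<in> ps_index"
  shows "AE x in lebesgue_on (tri s). piecewise p x = p s x"
proof -
  have "AE x in lebesgue_on (tri s). x \<in> tri s"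
    by (rule AE_I2) (simp add: space_restrict_space)
  with AE_tri_disjoint[OF s] show ?thesis
  proof eventually_elim
    case (elim x)
    have "piecewise p x = (\<Sum>t\<in>ps_index. if t = s then p s x else 0)"
      unfolding piecewise_def using elim by (intro sum.cong) (auto simp: indicator_def)
    then show ?case using s finite_ps_index by simp
  qed
qed

lemma piecewise_V2:
  assumes p: "\<And>s. s \<in> ps_index \<Longrightarrow> p s \<in> polys r"
  shows "piecewise p \<in> V2 r z"
proof -
  have "(\<lambda>x. indicator (tri s) x * p s x) \<in> L2_on T" if s: "s \<in> ps_index" for s
  proof -
    have c: "continuous_on T (p s)" using polys_continuous[OF p[OF s]] .
    obtain B where B: "\<And>x. x \<in> T \<Longrightarrow> \<bar>p s x\<bar> \<le> B"
      using compact_imp_bounded[OF compact_continuous_image[OF c T_compact]]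
      unfolding bounded_iff by auto
    show ?thesis
    proof (rule L2_on_bounded[OF T_lmeasurable])
      have "(indicator (tri s) :: real^2 \<Rightarrow> real) \<in> borel_measurable (lebesgue_on T)"
        by (intro measurable_restrict_space1 borel_measurable_indicator tri_sets)
      then show "(\<lambda>x. indicator (tri s) x * p s x) \<in> borel_measurable (lebesgue_on T)"
        by (rule borel_measurable_times) (rule continuous_imp_measurable_on_sets_lebesgue[OF c T_sets])
      show "\<bar>indicator (tri s) x * p s x\<bar> \<le> B" if "x \<in> T" for x
        using B[OF that] by (auto simp: indicator_def)
    qed
  qed
  from function_space_sum[OF function_space_L2_on finite_ps_index this, where c = "\<lambda>_. 1"]
  have "piecewise p \<in> L2_on T"
    unfolding piecewise_def[abs_def] by simp
  then show ?thesis
    unfolding V2_iff using p piecewise_ae by blast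
qed

lemma restr_piecewise:
  "\<lbrakk>s \<in> ps_index; p s \<in> polys r\<rbrakk> \<Longrightarrow> restr r (tri s) (piecewise p) = p s"
  by (rule restr_tri_eqI[where p = "p s"]) (auto intro: piecewise_ae)

section \<open>A basis of piecewise monomials\<close>

definition V2_index :: "nat \<Rightarrow> ((nat \<times> nat) \<times> nat \<times> nat) set" where
  "V2_index r = ps_index \<times> (SIGMA i:{..r}. {..r - i})"

definition V2_basis :: "(nat \<times> nat) \<times> nat \<times> nat \<Rightarrow> real^2 \<Rightarrow> real" where
  "V2_basis k = piecewise (\<lambda>s x. if s = fst k then (x $ 1) ^ fst (snd k) * (x $ 2) ^ snd (snd k) else 0)"

lemma finite_V2_index: "finite (V2_index r)"
  using finite_ps_index by (simp add: V2_index_def)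

lemma card_V2_index: "card (V2_index r) = 3 * (r + 1) * (r + 2)"
  using card_triangular_index[of r]
  by (simp only: V2_index_def card_cartesian_product card_ps_index)

text \<open>Grouping by triangle turns a linear combination into one arbitrary polynomial per
  triangle, which reduces independence and spanning to a single triangle.\<close>

lemma sum_V2_basis:
  "(\<Sum>k\<in>V2_index r. c k * V2_basis k x) =
     piecewise (\<lambda>s x. \<Sum>i\<le>r. \<Sum>j\<le>r - i. c (s, i, j) * (x $ 1) ^ i * (x $ 2) ^ j) x"
proof -
  have b: "V2_basis (s, i, j) x = indicator (tri s) x * ((x $ 1) ^ i * (x $ 2) ^ j)"
    if "s \<in> ps_index" for s i j
  proof -
    have "V2_basis (s, i, j) x
        = (\<Sum>t\<in>ps_index. if t = s then indicator (tri s) x * ((x $ 1) ^ i * (x $ 2) ^ j) else 0)"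
      unfolding V2_basis_def piecewise_def by (intro sum.cong) auto
    then show ?thesis using that finite_ps_index by simp
  qed
  have "(\<Sum>k\<in>V2_index r. c k * V2_basis k x)
      = (\<Sum>s\<in>ps_index. \<Sum>k\<in>(SIGMA i:{..r}. {..r - i}). c (s, k) * V2_basis (s, k) x)"
    unfolding V2_index_def sum.cartesian_product by (intro sum.cong) auto
  also have "\<dots> = (\<Sum>s\<in>ps_index. \<Sum>i\<le>r. \<Sum>j\<le>r - i. c (s, i, j) * V2_basis (s, i, j) x)"
    by (intro sum.cong refl) (subst sum.Sigma, auto intro!: sum.cong)
  also have "\<dots> = piecewise (\<lambda>s x. \<Sum>i\<le>r. \<Sum>j\<le>r - i. c (s, i, j) * (x $ 1) ^ i * (x $ 2) ^ j) x"
    unfolding piecewise_def by (intro sum.cong refl) (simp add: b sum_distrib_left mult_ac)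
  finally show ?thesis .
qed

lemma ae_basis_V2: "ae_basis_on T (V2 r z) (V2_index r) V2_basis"
  unfolding ae_basis_on_def
proof (intro conjI ballI allI impI)
  fix k assume "k \<in> V2_index r"
  then have "fst (snd k) + snd (snd k) \<le> r"
    by (auto simp: V2_index_def)
  from polys_monomial[OF this, of 1] polys_const[of 0 r] show "V2_basis k \<in> V2 r z"
    unfolding V2_basis_def by (intro piecewise_V2) (case_tac "s = fst k"; simp)
next
  fix c :: "(nat \<times> nat) \<times> nat \<times> nat \<Rightarrow> real" and k
  assume ae: "AE x in lebesgue_on T. (\<Sum>k\<in>V2_index r. c k * V2_basis k x) = 0" and k: "k \<in> V2_index r"
  obtain s i j where k': "k = (s, i, j)" by (metis prod.exhaust)
  with k have s: "s \<in> ps_index" and ij: "i \<le> r" "j \<le> r - i"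
    by (auto simp: V2_index_def)
  let ?p = "\<lambda>s x. \<Sum>i\<le>r. \<Sum>j\<le>r - i. c (s, i, j) * (x $ 1) ^ i * (x $ 2) ^ j"
  have "AE x in lebesgue_on (tri s). ?p s x = 0"
    using AE_tri[OF s ae] piecewise_ae[OF s, of ?p]
    unfolding sum_V2_basis by eventually_elim simp
  from coefficients_zero_ae[where m = "\<lambda>i. r - i" and c = "\<lambda>i j. c (s, i, j)",
      OF tri_sets interior_tri[OF s] this ij]
  show "c k = 0" by (simp add: k')
next
  fix q assume q: "q \<in> V2 r z"
  have "\<forall>s\<in>ps_index. \<exists>c. \<forall>x. restr r (tri s) q x = (\<Sum>i\<le>r. \<Sum>j\<le>r - i. c i j * (x $ 1) ^ i * (x $ 2) ^ j)"
    using restr_tri(1)[OF q] unfolding polys_def by blast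
  from bchoice[OF this] obtain c where c: "\<And>s x. s \<in> ps_index \<Longrightarrow>
      restr r (tri s) q x = (\<Sum>i\<le>r. \<Sum>j\<le>r - i. c s i j * (x $ 1) ^ i * (x $ 2) ^ j)"
    by blast
  let ?c = "\<lambda>k. c (fst k) (fst (snd k)) (snd (snd k))"
  have "AE x in lebesgue_on T. q x = (\<Sum>k\<in>V2_index r. ?c k * V2_basis k x)"
    unfolding AE_T_iff sum_V2_basis
  proof
    fix s assume s: "s \<in> ps_index"
    let ?p = "\<lambda>s x. \<Sum>i\<le>r. \<Sum>j\<le>r - i. ?c (s, i, j) * (x $ 1) ^ i * (x $ 2) ^ j"
    from restr_tri(2)[OF q s] piecewise_ae[OF s, of ?p]
    show "AE x in lebesgue_on (tri s). q x = piecewise ?p x"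
      by eventually_elim (simp add: c[OF s])
  qed
  then show "\<exists>c. AE x in lebesgue_on T. q x = (\<Sum>k\<in>V2_index r. c k * V2_basis k x)"
    by (rule exI[of _ ?c])
qed

lemma ae_has_dim_V2: "ae_has_dim T (V2 r z) (3 * (r + 1) * (r + 2))"
  using ae_has_dim_card[OF finite_V2_index ae_basis_V2] by (simp only: card_V2_index)

section \<open>Continuity at the edge points in terms of jumps\<close>

lemma ae_continuous_at_iff_jump_dof:
  assumes i: "i \<in> {1..3}" and q: "q \<in> V2 r z"
  shows "ae_continuous_at T q (z (3 + i)) \<longleftrightarrow> jump_dof r z i q = 0"
proof -
  let ?y = "z (3 + i)" and ?A = "tri (i, nxt i)" and ?B = "tri (i, nxt (nxt i))"
  let ?p = "restr r ?A q" and ?p' = "restr r ?B q"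
  have s: "(i, nxt i) \<in> ps_index" "(i, nxt (nxt i)) \<in> ps_index"
    using nxt_ps_index[OF i] by blast+
  have y: "?y \<in> ?A" "?y \<in> ?B"
    using edge_point_in_tri[of "(i, nxt i)"] edge_point_in_tri[of "(i, nxt (nxt i))"] by simp_all
  show ?thesis
  proof
    assume "ae_continuous_at T q ?y"
    then obtain g where g: "AE x in lebesgue_on T. g x = q x" "continuous (at ?y within T) g"
      unfolding ae_continuous_at_def by blast
    \<comment> \<open>Applied to both triangles at the edge point, this identifies the two traces
      with the same number \<open>g ?y\<close>.\<close>
    have "g ?y = restr r (tri s) q ?y" if s: "s \<in> ps_index" "?y \<in> tri s" for s
    proof (rule closure_interior_ae_eq_at[OF tri_sets[of s]])
      show "?y \<in> closure (interior (tri s))" using s by (simp add: closure_interior_tri)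
      show "continuous (at ?y within tri s) g"
        using g(2) tri_subset_T[OF s(1)] by (rule continuous_within_subset)
      show "continuous_on UNIV (restr r (tri s) q)"
        by (rule polys_continuous[OF restr_tri(1)[OF q s(1)]])
      show "AE x in lebesgue_on (tri s). g x = restr r (tri s) q x"
        using AE_tri[OF s(1) g(1)] restr_tri(2)[OF q s(1)] by eventually_elim simp
    qed
    from this[OF s(1) y(1)] this[OF s(2) y(2)] show "jump_dof r z i q = 0"
      unfolding jump_dof_eq[OF i] by simp
  next
    assume "jump_dof r z i q = 0"
    then have eq: "?p ?y = ?p' ?y"
      unfolding jump_dof_eq[OF i] by simp
    \<comment> \<open>The representative equals the polynomials everywhere on the two triangles,
      including null sets where \<open>q\<close> may differ. On the rest of their common edge the
      choice of \<open>?p\<close> is harmless, as continuity is needed only at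
      \<open>?y\<close>.\<close>
    define g where "g x = (if x \<in> ?A then ?p x else if x \<in> ?B then ?p' x else q x)" for x
    have "AE x in lebesgue_on T. g x = q x"
    proof -
      have "AE x in lebesgue. x \<in> ?A \<longrightarrow> q x = ?p x" "AE x in lebesgue. x \<in> ?B \<longrightarrow> q x = ?p' x"
        using restr_tri(2)[OF q s(1)] restr_tri(2)[OF q s(2)]
        by (simp_all only: AE_lebesgue_on_iff[OF tri_sets])
      then have "AE x in lebesgue. g x = q x"
        by eventually_elim (auto simp: g_def)
      then show ?thesis
        unfolding AE_lebesgue_on_iff[OF T_sets] by eventually_elim simp
    qed
    moreover have "continuous (at ?y within T) g"
      unfolding continuous_within_eps_delta
    proof (intro allI impI)
      fix e :: real assume e: "e > 0"
      \<comment> \<open>The four triangles of the other sectors; a ball around \<open>?y\<close>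
        avoiding them meets the big triangle only in \<open>?A\<close> and
        \<open>?B\<close>.\<close>
      let ?C = "\<Union>t\<in>{t \<in> ps_index. fst t \<noteq> i}. tri t"
      have "closed ?C"
        using finite_ps_index compact_tri by (intro closed_UN) (auto intro: compact_imp_closed)
      then have "open (- ?C)" by (rule open_Compl)
      moreover have "?y \<in> - ?C"
        using edge_point_notin_tri[OF i] by blast
      ultimately obtain d0 where d0: "d0 > 0" "ball ?y d0 \<subseteq> - ?C"
        by (rule openE)
      have cont: "isCont ?p ?y" "isCont ?p' ?y"
        by (rule polys_isCont[OF restr_tri(1)[OF q s(1)]], rule polys_isCont[OF restr_tri(1)[OF q s(2)]])
      obtain d1 where d1: "d1 > 0" "\<And>x. dist x ?y < d1 \<Longrightarrow> dist (?p x) (?p ?y) < e"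
        using cont(1)[unfolded continuous_at_eps_delta, rule_format, OF e] by blast
      obtain d2 where d2: "d2 > 0" "\<And>x. dist x ?y < d2 \<Longrightarrow> dist (?p' x) (?p' ?y) < e"
        using cont(2)[unfolded continuous_at_eps_delta, rule_format, OF e] by blast
      have "dist (g x) (g ?y) < e" if x: "x \<in> T" "dist x ?y < min d0 (min d1 d2)" for x
      proof -
        obtain t where t: "t \<in> ps_index" "x \<in> tri t"
          using x(1) unfolding big_triangle_eq by blast
        have "fst t = i"
        proof (rule ccontr)
          assume "fst t \<noteq> i"
          then have "x \<in> ?C" using t by blast
          moreover have "x \<in> ball ?y d0" using x(2) by (simp add: dist_commute)
          ultimately show False using d0(2) by blast
        qed
        then have "x \<in> ?A \<or> x \<in> ?B"
          using ps_index_cases(2)[OF t(1)] t(2) by metis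
        moreover have "g ?y = ?p ?y" using y by (simp add: g_def)
        ultimately show ?thesis
          using d1(2)[of x] d2(2)[of x] x(2) eq by (auto simp: g_def)
      qed
      then show "\<exists>d>0. \<forall>x\<in>T. dist x ?y < d \<longrightarrow> dist (g x) (g ?y) < e"
        using d0(1) d1(1) d2(1) by (intro exI[of _ "min d0 (min d1 d2)"]) auto
    qed
    ultimately show "ae_continuous_at T q ?y"
      unfolding ae_continuous_at_def by blast
  qed
qed

text \<open>The nested form matches four successive uses of
  \<open>ae_has_dim_kernel\<close>.\<close>

lemma V2_ring_eq:
  "V2_ring r z = {q\<in>{q\<in>{q\<in>{q\<in>V2 r z. jump_dof r z 1 q = 0}. jump_dof r z 2 q = 0}. jump_dof r z 3 q = 0}.
     integral\<^sup>L (lebesgue_on T) q = 0}"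
  unfolding V2_ring_def index_set
  using ae_continuous_at_iff_jump_dof[of 1] ae_continuous_at_iff_jump_dof[of 2]
    ae_continuous_at_iff_jump_dof[of 3] by auto

section \<open>Independence of the four functionals and the dimension of the kernel\<close>

lemma jump_dof_piecewise:
  assumes i: "i \<in> {1..3}" and p: "\<And>s. s \<in> ps_index \<Longrightarrow> p s \<in> polys r"
  shows "jump_dof r z i (piecewise p) = p (i, nxt i) (z (3 + i)) - p (i, nxt (nxt i)) (z (3 + i))"
proof -
  have s: "(i, nxt i) \<in> ps_index" "(i, nxt (nxt i)) \<in> ps_index"
    using nxt_ps_index[OF i] by blast+
  show ?thesis
    unfolding jump_dof_eq[OF i] restr_piecewise[where p = p, OF s(1) p[OF s(1)]]
      restr_piecewise[where p = p, OF s(2) p[OF s(2)]] ..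
qed

text \<open>The function is nonnegative everywhere, so a zero integral would make it vanish almost
  everywhere, and the constant polynomials 1 and 0 would agree on a triangle.\<close>

lemma integral_piecewise_1: "integral\<^sup>L (lebesgue_on T) (piecewise (\<lambda>_ _. 1)) \<noteq> 0"
proof
  let ?w = "piecewise (\<lambda>_ _. 1)"
  assume 0: "integral\<^sup>L (lebesgue_on T) ?w = 0"
  have "?w \<in> V2 0 z" by (rule piecewise_V2) (rule polys_const)
  then have "integrable (lebesgue_on T) ?w"
    by (intro integrable_L2_on T_lmeasurable V2_L2)
  moreover have "AE x in lebesgue_on T. 0 \<le> ?w x"
    by (intro AE_I2) (simp add: piecewise_def sum_nonneg)
  ultimately have ae: "AE x in lebesgue_on T. ?w x = 0"
    using 0 integral_nonneg_eq_0_iff_AE by blast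
  have s: "(1, 2) \<in> ps_index" by (simp add: ps_index_eq)
  have "AE x in lebesgue_on (tri (1, 2)). (\<lambda>x. 1) x = (0::real)"
    using AE_tri[OF s ae] piecewise_ae[OF s, of "\<lambda>_ _. 1"] by eventually_elim simp
  with polys_unique_ae[OF polys_const[of 1 0] polys_const[of 0 0] tri_sets interior_tri[OF s]]
  show False by (simp add: fun_eq_iff)
qed

lemma ae_has_dim_V2_ring: "ae_has_dim T (V2_ring r z) (3 * (r + 1) * (r + 2) - 4)"
proof -
  let ?n = "3 * (r + 1) * (r + 2) - 4"
  let ?J = "jump_dof r z"
  let ?V1 = "{q\<in>V2 r z. ?J 1 q = 0}" let ?V2 = "{q\<in>?V1. ?J 2 q = 0}" let ?V3 = "{q\<in>?V2. ?J 3 q = 0}"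
  \<comment> \<open>The jump of \<open>?w i\<close> is 1 at \<open>z (3 + i)\<close> and 0 at the
    other two points, so it survives in the kernels taken before the \<open>i\<close>-th
    step.\<close>
  let ?w = "\<lambda>i. piecewise (\<lambda>s x. if s = (i, nxt i) then 1 else 0)"
  have w: "?w i \<in> V2 r z" for i
    by (rule piecewise_V2) (auto intro: polys_const)
  have Jw: "?J i (?w i') = (if i = i' then 1 else 0)" if "i \<in> {1..3}" "i' \<in> {1..3}" for i i'
    using that nxt_index(5)[of i]
    by (subst jump_dof_piecewise) (auto intro: polys_const)
  let ?e = "piecewise (\<lambda>_ _. 1)"
  have e: "?e \<in> V2 r z"
    by (rule piecewise_V2) (rule polys_const)
  have Je: "?J i ?e = 0" if "i \<in> {1..3}" for i
    using that by (subst jump_dof_piecewise) (auto intro: polys_const)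
  have J: "ae_functional T (V2 r z) (?J i)" if "i \<in> {1..3}" for i
    using that by (rule ae_functional_jump_dof)
  have fs1: "function_space ?V1"
    by (intro function_space_kernel[OF function_space_V2 J]) simp
  have J2: "ae_functional T ?V1 (?J 2)" and J3: "ae_functional T ?V2 (?J 3)"
    by (rule ae_functional_subset[OF J], simp, blast)+
  have fs2: "function_space ?V2" by (rule function_space_kernel[OF fs1 J2])
  have fs3: "function_space ?V3" by (rule function_space_kernel[OF fs2 J3])
  have I: "ae_functional T ?V3 (integral\<^sup>L (lebesgue_on T))"
    by (rule ae_functional_subset[OF ae_functional_integral]) blast
  \<comment> \<open>The truncated subtraction is exact, because \<open>3 * (r + 1) * (r + 2)\<close>
    is at least 6.\<close>
  have "Suc (Suc (Suc (Suc ?n))) = 3 * (r + 1) * (r + 2)"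
    by simp
  then have "ae_has_dim T (V2 r z) (Suc (Suc (Suc (Suc ?n))))"
    using ae_has_dim_V2[of r] by (simp only:)
  from ae_has_dim_kernel[OF function_space_V2 J this, of 1 "?w 1"]
  have "ae_has_dim T ?V1 (Suc (Suc (Suc ?n)))"
    using w Jw by simp
  from ae_has_dim_kernel[OF fs1 J2 this, of "?w 2"]
  have "ae_has_dim T ?V2 (Suc (Suc ?n))"
    using w Jw by simp
  from ae_has_dim_kernel[OF fs2 J3 this, of "?w 3"]
  have "ae_has_dim T ?V3 (Suc ?n)"
    using w Jw by simp
  from ae_has_dim_kernel[OF fs3 I this, of ?e]
  show ?thesis
    unfolding V2_ring_eq using e Je integral_piecewise_1 by simp
qed

section \<open>Orthogonality and unisolvence\<close>

lemma V2_ring_L2: "q \<in> V2_ring r z \<Longrightarrow> q \<in> L2_on T"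
  using V2_L2 unfolding V2_ring_def by blast

lemma L2_self_orthogonal:
  assumes "q \<in> L2_on T" "(LINT x|lebesgue_on T. q x * q x) = 0"
  shows "AE x in lebesgue_on T. q x = 0"
proof -
  have "integrable (lebesgue_on T) (\<lambda>x. q x * q x)"
    using assms(1) by (intro integrable_L2_mult)
  then have "AE x in lebesgue_on T. q x * q x = 0"
    using assms(2) by (subst (asm) integral_nonneg_eq_0_iff_AE) auto
  then show ?thesis by simp
qed

text \<open>Expanding one factor of \<open>q x * q x\<close> in the basis writes the squared norm of
  \<open>q\<close> as a combination of the vanishing moments.\<close>

lemma orthogonal_to_basis:
  assumes b: "ae_basis T W n b" and W: "W \<subseteq> L2_on T" and q: "q \<in> W"
    and orth: "\<And>k. k < n \<Longrightarrow> (LINT x|lebesgue_on T. q x * b k x) = 0"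
  shows "AE x in lebesgue_on T. q x = 0"
proof (rule L2_self_orthogonal)
  show qL: "q \<in> L2_on T" using q W by blast
  have bL: "b k \<in> L2_on T" if "k < n" for k
    using that b W unfolding ae_basis_def by blast
  obtain c where c: "AE x in lebesgue_on T. q x = (\<Sum>k<n. c k * b k x)"
    using b q unfolding ae_basis_def by meson
  have int: "integrable (lebesgue_on T) (\<lambda>x. c k * (q x * b k x))" if "k < n" for k
    using integrable_L2_mult[OF qL bL[OF that]] by simp
  have "(LINT x|lebesgue_on T. q x * q x) = (LINT x|lebesgue_on T. (\<Sum>k<n. c k * (q x * b k x)))"
  proof (rule integral_cong_AE)
    show "(\<lambda>x. q x * q x) \<in> borel_measurable (lebesgue_on T)"
      using integrable_L2_mult[OF qL qL] by (rule borel_measurable_integrable)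
    show "(\<lambda>x. \<Sum>k<n. c k * (q x * b k x)) \<in> borel_measurable (lebesgue_on T)"
      using int by (intro borel_measurable_sum borel_measurable_integrable) auto
    show "AE x in lebesgue_on T. q x * q x = (\<Sum>k<n. c k * (q x * b k x))"
      using c
    proof eventually_elim
      case (elim x)
      have "q x * q x = q x * (\<Sum>k<n. c k * b k x)" using elim by simp
      also have "\<dots> = (\<Sum>k<n. c k * (q x * b k x))"
        by (simp add: sum_distrib_left mult_ac)
      finally show ?case .
    qed
  qed
  also have "\<dots> = (\<Sum>k<n. c k * (LINT x|lebesgue_on T. q x * b k x))"
    using int by (subst Bochner_Integration.integral_sum) auto
  also have "\<dots> = 0" using orth by simp
  finally show "(LINT x|lebesgue_on T. q x * q x) = 0" .
qed

lemma unisolvent_dofs: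
  assumes b: "ae_basis T (V2_ring r z) n b" and n: "n = 3 * (r + 1) * (r + 2) - 4"
  shows "unisolvent T (V2 r z) (dofs r z n b)"
  unfolding unisolvent_def
proof (intro conjI ballI impI)
  have "length (dofs r z n b) = 3 * (r + 1) * (r + 2)"
    unfolding dofs_def n by simp
  then show "ae_has_dim T (V2 r z) (length (dofs r z n b))"
    by (simp only: ae_has_dim_V2)
  fix q assume q: "q \<in> V2 r z" and zero: "\<forall>l\<in>set (dofs r z n b). l q = 0"
  have ring: "q \<in> V2_ring r z"
    unfolding V2_ring_eq using q zero by (simp add: dofs_def)
  have sub: "V2_ring r z \<subseteq> L2_on T"
    using V2_ring_L2 by blast
  show "AE x in lebesgue_on T. q x = 0"
  proof (rule orthogonal_to_basis[OF b sub ring])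
    show "(LINT x|lebesgue_on T. q x * b k x) = 0" if "k < n" for k
      using zero that by (auto simp: dofs_def)
  qed
qed

text \<open>The basis-free form of uniqueness: \<open>q\<close> itself is an admissible test
  function.\<close>

lemma orthogonal_to_V2_ring:
  assumes q: "q \<in> V2 r z" "\<And>i. i \<in> {1..3} \<Longrightarrow> jump r z q i = 0" "integral\<^sup>L (lebesgue_on T) q = 0"
    and orth: "\<And>p. p \<in> V2_ring r z \<Longrightarrow> (LINT x|lebesgue_on T. q x * p x) = 0"
  shows "AE x in lebesgue_on T. q x = 0"
proof -
  have "q \<in> V2_ring r z"
    unfolding V2_ring_eq using q by (simp add: jump_dof_def)
  then show ?thesis
    using L2_self_orthogonal[OF V2_L2[OF q(1)]] orth by blast
qed

end

text \<open>The dimension of \<open>V2_ring r z\<close> supplies a basis, so the quantification over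
  \<open>b\<close> is not vacuous and the number of moments is the claimed one. The last conjunct
  states uniqueness independently of a basis, with the jumps as vectors.\<close>

theorem lemma4p6:
  fixes z :: "nat \<Rightarrow> real^2" and r :: nat
  assumes "powell_sabin z"
  shows "ae_has_dim (big_triangle z) (V2 r z) (3 * (r + 1) * (r + 2)) \<and>
    ae_has_dim (big_triangle z) (V2_ring r z) (3 * (r + 1) * (r + 2) - 4) \<and>
    (\<forall>b. ae_basis (big_triangle z) (V2_ring r z) (3 * (r + 1) * (r + 2) - 4) b \<longrightarrow>
       unisolvent (big_triangle z) (V2 r z) (dofs r z (3 * (r + 1) * (r + 2) - 4) b)) \<and>
    (\<forall>q\<in>V2 r z.
       (\<forall>i\<in>{1..3}. jump r z q i = 0) \<and>
       integral\<^sup>L (lebesgue_on (big_triangle z)) q = 0 \<and>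
       (\<forall>p\<in>V2_ring r z. (LINT x|lebesgue_on (big_triangle z). q x * p x) = 0) \<longrightarrow>
       (AE x in lebesgue_on (big_triangle z). q x = 0))"
proof -
  interpret ps_config z using assms by unfold_locales
  show ?thesis
    using ae_has_dim_V2 ae_has_dim_V2_ring unisolvent_dofs orthogonal_to_V2_ring by blast
qed

end
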